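(* Let $H$ be a separable real Hilbert space and let $X$ be an $H$-valued random variable satisfying assumptions (A1), (A2) and (A3) stated in the context, with geometric median $m$. Let $\gamma_n=c_\gamma n^{-\alpha}$ for $n\ge1$, with $c_\gamma>0$ and $\alpha\in(\tfrac12,1)$, and let $(Z_n)$ be the stochastic gradient algorithm defined in the context, on a probability space with sample space $\Omega$. Then there exist an increasing sequence of events $(\Omega_N)_{N\in\mathbb{N}}$ with $\Omega=\bigcup_{N\in\mathbb{N}}\Omega_N$, and constants $C_N$, such that for every $N$ and all sufficiently large $n$ (depending on $N$), $$\mathbb{E}\left[\mathbf{1}_{\Omega_N}\|Z_n-m\|^2\right]\le C_N\,\gamma_n\ln\left(\sum_{k=1}^n\gamma_k\right)\quad\text{and}\quad \mathbb{E}\left[\mathbf{1}_{\Omega_N}\|Z_n-m\|^2\right]\le C_N\,\frac{\ln(n)}{n^\alpha}.$$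
   Context: $\langle\cdot,\cdot\rangle$ and $\|\cdot\|$ denote the inner product and norm of $H$. Geometric median: $m=\arg\min_{u\in H}\mathbb{E}\left[\|X-u\|-\|X\|\right]$ (no moment of $X$ is assumed; under (A1) the minimizer is unique). (A1) $X$ is not concentrated on a straight line: for every $v\in H$ there is $w\in H$ with $\langle v,w\rangle=0$ and $\mathrm{Var}(\langle w,X\rangle)>0$. (Since no moment is assumed, the variance may be $+\infty$; the condition means that $\langle w,X\rangle$ is not almost surely constant.) (A2) The law of $X$ is a mixture $\mu_X=\lambda\mu_c+(1-\lambda)\mu_d$, $\lambda\in[0,1]$, of two probability measures such that: (i) if $Y$ has law $\mu_c$, then for every $A>0$ there is $C_A\in[0,\infty)$ such that $\mathbb{E}\left[\|Y-\alpha\|^{-1}\right]\le C_A$ for all $\alpha\in H$ with $\|\alpha\|\le A$; (ii) $\mu_d=\sum_i p_i\delta_{x_i}$ is a discrete measure, with support $D$, and $m\notin D$. (A3) There are a constant $A>0$ and a constant $C_A\in[0,\infty)$ such that $\mathbb{E}\left[\|X-(m+h)\|^{-2}\right]\le C_A$ for all $h\in H$ with $\|h\|\le A$. Algorithm: $X_1,X_2,\dots$ are independent copies of $X$. The starting point $Z_0$ is either deterministic, or random, bounded and independent of $(X_n)_{n\ge1}$ (e.g. $Z_0=X_0\mathbf{1}_{\{\|X_0\|\le M\}}$ with $X_0$ an independent copy of $X$ and $M>0$ a constant). For $n\ge 0$, $$Z_{n+1}=Z_n+\gamma_n\frac{X_{n+1}-Z_n}{\|X_{n+1}-Z_n\|},$$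 with the convention $Z_{n+1}=Z_n$ if $X_{n+1}=Z_n$; the first step $\gamma_0$ is an arbitrary fixed positive number. *)

theory Defs
  imports "HOL-Probability.Probability"
begin

text \<open>Variance with values in \<open>[0, \<infinity>]\<close>; it is \<open>\<infinity>\<close> when there is no first or no second moment.\<close>

definition ext_variance :: "'p measure \<Rightarrow> ('p \<Rightarrow> real) \<Rightarrow> ennreal" where
  "ext_variance P Y =
     (if integrable P Y then (\<integral>\<^sup>+\<omega>. ennreal ((Y \<omega> - (\<integral>\<omega>'. Y \<omega>' \<partial>P))\<^sup>2) \<partial>P) else \<infinity>)"

lemma ext_variance_pos_iff:
  assumes "prob_space P" and Y: "Y \<in> borel_measurable P"
  shows "ext_variance P Y > 0 \<longleftrightarrow> \<not> (\<exists>c. AE \<omega> in P. Y \<omega> = c)"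
proof -
  interpret prob_space P by fact
  have const: "integrable P Y \<and> expectation Y = c" if c: "AE \<omega> in P. Y \<omega> = c" for c
  proof
    show "integrable P Y"
      using integrable_cong_AE[OF Y _ c] by simp
    show "expectation Y = c"
      using integral_cong_AE[OF Y _ c] by (simp add: prob_space)
  qed
  show ?thesis
  proof (cases "integrable P Y")
    case True
    have "ext_variance P Y = 0 \<longleftrightarrow> (AE \<omega> in P. Y \<omega> = expectation Y)"
      using True Y by (simp add: ext_variance_def nn_integral_0_iff_AE ennreal_eq_0_iff)
    also have "\<dots> \<longleftrightarrow> (\<exists>c. AE \<omega> in P. Y \<omega> = c)"
      using const by blast
    finally show ?thesis
      by (metis zero_less_iff_neq_zero)
  next
    case False
    then show ?thesis
      using const by (auto simp: ext_variance_def)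
  qed
qed

text \<open>The difference \<open>\<parallel>X - u\<parallel> - \<parallel>X\<parallel>\<close> is bounded by \<open>\<parallel>u\<parallel>\<close>, so on a probability space
  the integral below exists without any moment condition on \<open>X\<close>.\<close>

definition is_geometric_median :: "'p measure \<Rightarrow> ('p \<Rightarrow> 'h::real_normed_vector) \<Rightarrow> 'h \<Rightarrow> bool" where
  "is_geometric_median P X m \<longleftrightarrow>
     is_arg_min (\<lambda>u. \<integral>\<omega>. (norm (X \<omega> - u) - norm (X \<omega>)) \<partial>P) (\<lambda>_. True) m"

definition not_on_line :: "'p measure \<Rightarrow> ('p \<Rightarrow> 'h::real_inner) \<Rightarrow> bool" where
  "not_on_line P X \<longleftrightarrow>
     (\<forall>v. \<exists>w. inner v w = 0 \<and> ext_variance P (\<lambda>\<omega>. inner w (X \<omega>)) > 0)"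

text \<open>Moments of order \<open>-1\<close> and \<open>-2\<close> are integrals in \<^typ>\<open>ennreal\<close>, where
  \<open>inverse 0 = \<infinity>\<close>; with the real inverse an atom at the centre would be ignored.

  The discrete part \<open>\<Sum>\<^sub>i p\<^sub>i \<delta>\<^bsub>x\<^sub>i\<^esub>\<close> is a probability mass function \<open>q\<close>,
  whose support \<^term>\<open>set_pmf q\<close> is the set of the points \<open>x\<^sub>i\<close> with \<open>p\<^sub>i > 0\<close>.\<close>

definition mixture_condition ::
    "'p measure \<Rightarrow> ('p \<Rightarrow> 'h::real_normed_vector) \<Rightarrow> 'h \<Rightarrow> bool" where
  "mixture_condition P X m \<longleftrightarrow>
     (\<exists>l \<mu>c (q :: 'h pmf).
        0 \<le> l \<and> l \<le> 1 \<and> prob_space \<mu>c \<and> sets \<mu>c = sets borel \<and>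
        (\<forall>B\<in>sets borel. measure (distr P borel X) B =
           l * measure \<mu>c B + (1 - l) * measure (measure_pmf q) B) \<and>
        (\<forall>A>0. \<exists>C\<ge>0. \<forall>a. norm a \<le> A \<longrightarrow>
           (\<integral>\<^sup>+y. inverse (ennreal (norm (y - a))) \<partial>\<mu>c) \<le> ennreal C) \<and>
        m \<notin> set_pmf q)"

definition inverse_square_condition ::
    "'p measure \<Rightarrow> ('p \<Rightarrow> 'h::real_normed_vector) \<Rightarrow> 'h \<Rightarrow> bool" where
  "inverse_square_condition P X m \<longleftrightarrow>
     (\<exists>A>0. \<exists>C\<ge>0. \<forall>h. norm h \<le> A \<longrightarrow>
        (\<integral>\<^sup>+\<omega>. inverse (ennreal (norm (X \<omega> - (m + h)))) ^ 2 \<partial>P) \<le> ennreal C)"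

text \<open>Only the values \<open>X n\<close> with \<open>n \<ge> 1\<close> of the sample are used.\<close>

primrec median_sgd ::
    "(nat \<Rightarrow> real) \<Rightarrow> ('o \<Rightarrow> 'h::real_normed_vector) \<Rightarrow> (nat \<Rightarrow> 'o \<Rightarrow> 'h) \<Rightarrow> nat \<Rightarrow> 'o \<Rightarrow> 'h" where
  "median_sgd \<gamma> Z0 X 0 = Z0"
| "median_sgd \<gamma> Z0 X (Suc n) = (\<lambda>\<omega>.
     let z = median_sgd \<gamma> Z0 X n \<omega>; x = X (Suc n) \<omega>
     in if x = z then z else z + (\<gamma> n / norm (x - z)) *\<^sub>R (x - z))"

end

theory Submission
  imports Defs "HOL-Real_Asymp.Real_Asymp"
begin

text \<open>The gradient of the convex function \<open>G(u) = E[\<parallel>X - u\<parallel> - \<parallel>X\<parallel>]\<close> is strongly monotone at \<open>m\<close> on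
  every ball: with \<open>b = m - X\<close> the pointwise subgradient inequality for the norm has an excess of order
  \<open>\<parallel>h\<parallel>\<^sup>2 sin\<^sup>2(h, b)\<close>, and since \<open>X\<close> is not on a line, its expectation is at least \<open>k \<parallel>h\<parallel>\<^sup>2\<close> for
  \<open>\<parallel>h\<parallel> \<le> R\<close>. Up to the exit time of the ball of radius \<open>R\<close> about \<open>m\<close> the truncated error
  therefore satisfies \<open>e\<^sub>n\<^sub>+\<^sub>1 \<le> (1 - 2 k \<gamma>\<^sub>n) e\<^sub>n + \<gamma>\<^sub>n\<^sup>2\<close>, so \<open>e\<^sub>n = O(n powr -\<alpha>)\<close>, even without
  the logarithm. As \<open>\<Sum> \<gamma>\<^sub>n\<^sup>2 < \<infinity>\<close>, a maximal inequality shows that almost every trajectory stays in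
  some ball, and \<open>\<Omega>\<^sub>N\<close> is the event of never leaving the ball of radius \<open>N + 1\<close>, enlarged by a
  null set.\<close>

subsection \<open>Strong monotonicity at the geometric median\<close>

text \<open>For nonzero \<open>a\<close> and \<open>b\<close>, the excess of the right side over
  \<open>norm a - norm b\<close> is exactly \<open>(p - inner a b) / norm a\<close> with
  \<open>p = norm a * norm b\<close>. The Gram determinant of \<open>h\<close> and \<open>b\<close>
  is also that of \<open>a\<close> and \<open>b\<close>, so it factors as
  \<open>(p - inner a b) * (p + inner a b)\<close>, and Cauchy-Schwarz bounds the second factor by
  \<open>2 * p\<close>.\<close>

lemma inner_sgn_ge_norm_diff:
  fixes a b h :: "'h::real_inner"
  assumes a: "a = b + h" and K: "norm a \<le> K"
  shows "norm a - norm b + ((norm h)\<^sup>2 * (norm b)\<^sup>2 - (inner h b)\<^sup>2) / (2 * K\<^sup>2 * norm b)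
           \<le> inner h (sgn a)"
proof (cases "a = 0 \<or> b = 0")
  case True
  \<comment> \<open>For \<open>b = 0\<close> the fraction is 0 by division by zero and both sides
    equal \<open>norm h\<close>; for \<open>a = 0\<close> the numerator vanishes and
    \<open>sgn 0 = 0\<close>.\<close>
  show ?thesis
  proof (cases "b = 0")
    case True
    then show ?thesis
      using a by (cases "h = 0")
        (simp_all add: sgn_div_norm power2_norm_eq_inner[symmetric] power2_eq_square field_simps)
  next
    case False
    with True a have "h = - b"
      by (metis add_eq_0_iff)
    then show ?thesis
      using True False by (simp add: power2_eq_square power2_norm_eq_inner[symmetric])
  qed
next
  case False
  define q where "q = (norm h)\<^sup>2 * (norm b)\<^sup>2 - (inner h b)\<^sup>2"
  define p where "p = norm a * norm b"
  have p: "p > 0" using False by (simp add: p_def)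
  have ab: "\<bar>inner a b\<bar> \<le> p" unfolding p_def by (rule Cauchy_Schwarz_ineq2)
  have nb: "(norm b)\<^sup>2 = inner b b" and nh: "(norm h)\<^sup>2 = inner h h"
    by (simp_all add: power2_norm_eq_inner)
  have ab_eq: "inner a b = inner b b + inner h b"
    by (simp add: a inner_add_left)
  have p2: "p\<^sup>2 = (inner b b + 2 * inner h b + inner h h) * inner b b"
  proof -
    have "(norm a)\<^sup>2 = inner b b + 2 * inner h b + inner h h"
      unfolding power2_norm_eq_inner a by (simp add: inner_add_left inner_add_right inner_commute[of b h])
    then show ?thesis by (simp add: p_def power_mult_distrib nb)
  qed
  have "(p - inner a b) * (p + inner a b) = p\<^sup>2 - (inner a b)\<^sup>2"
    by (simp add: power2_eq_square algebra_simps)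
  also have "\<dots> = q"
    unfolding p2 ab_eq q_def nb nh by (simp add: power2_eq_square algebra_simps)
  finally have q: "q = (p - inner a b) * (p + inner a b)" ..
  have q0: "0 \<le> q" using ab by (simp add: q abs_le_iff)
  have "q \<le> (p - inner a b) * (2 * p)"
    unfolding q using ab by (intro mult_left_mono) (auto simp: abs_le_iff)
  then have "q / (2 * p) \<le> p - inner a b"
    using p by (simp add: field_simps)
  have "K > 0" using K False zero_less_norm_iff[of a] by linarith
  then have "q / (2 * K\<^sup>2 * norm b) \<le> q / (2 * (norm a)\<^sup>2 * norm b)"
    using K False q0 by (intro divide_left_mono mult_right_mono mult_left_mono power_mono mult_pos_pos) auto
  also have "\<dots> = q / (2 * p) / norm a"
    by (simp add: p_def power2_eq_square field_simps)
  also have "\<dots> \<le> (p - inner a b) / norm a"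
    by (intro divide_right_mono) (fact, simp)
  also have "\<dots> = inner h (sgn a) - (norm a - norm b)"
  proof -
    have "inner h a = (norm a)\<^sup>2 - inner a b"
      unfolding power2_norm_eq_inner a by (simp add: inner_add_left inner_add_right inner_commute[of b h])
    then show ?thesis
      using False by (simp add: sgn_div_norm p_def field_simps power2_eq_square)
  qed
  finally show ?thesis by (simp add: q_def)
qed

text \<open>Cauchy-Schwarz for \<open>w\<close> against \<open>p\<close>, which is
  \<open>(norm h)\<^sup>2\<close> times the component of \<open>b\<close> orthogonal to
  \<open>h\<close>. The Gram determinant is thereby traded for the square of a linear functional of
  \<open>b\<close>, whose expectation is a quadratic form in \<open>w\<close>.\<close>

lemma orthogonal_gram_bound:
  fixes w h b :: "'h::real_inner"
  assumes "inner w h = 0"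
  shows "(norm h)\<^sup>2 * (inner w b)\<^sup>2 \<le> (norm w)\<^sup>2 * ((norm h)\<^sup>2 * (norm b)\<^sup>2 - (inner h b)\<^sup>2)"
proof (cases "h = 0")
  case False
  define p where "p = (norm h)\<^sup>2 *\<^sub>R b - inner h b *\<^sub>R h"
  have 1: "inner w p = (norm h)\<^sup>2 * inner w b"
    using assms by (simp add: p_def inner_simps)
  have 2: "inner p p = (norm h)\<^sup>2 * ((norm h)\<^sup>2 * (norm b)\<^sup>2 - (inner h b)\<^sup>2)"
    unfolding p_def power2_norm_eq_inner
    by (simp add: inner_diff_left inner_diff_right inner_commute[of b h] power2_eq_square algebra_simps)
  have "(norm h)\<^sup>2 * ((norm h)\<^sup>2 * (inner w b)\<^sup>2) \<le> 
     (norm h)\<^sup>2 * ((norm w)\<^sup>2 * ((norm h)\<^sup>2 * (norm b)\<^sup>2 - (inner h b)\<^sup>2))"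
    using Cauchy_Schwarz_ineq[of w p] unfolding 1 2
    by (simp add: power2_norm_eq_inner[symmetric] power_mult_distrib power2_eq_square mult_ac)
  then show ?thesis
    by (rule mult_left_le_imp_le) (use False in simp)
qed simp

text \<open>Testing against a countable dense set turns the pairwise proportionality into collinearity
  with a single vector \<open>g\<close>, namely a value of \<open>b\<close>.\<close>

lemma AE_collinearI:
  fixes b :: "'p \<Rightarrow> 'h::{real_inner, second_countable_topology}"
  assumes deg: "\<And>d. \<exists>r. AE \<omega> in P. inner d (b \<omega>) = r * inner w (b \<omega>)"
    and nz: "\<not> (AE \<omega> in P. inner w (b \<omega>) = 0)"
  shows "\<exists>g. AE \<omega> in P. \<forall>v. inner v g = 0 \<longrightarrow> inner v (b \<omega>) = 0"
proof -
  obtain r where r: "\<And>d. AE \<omega> in P. inner d (b \<omega>) = r d * inner w (b \<omega>)"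
    using deg by metis
  obtain D :: "'h set" where D: "countable D" "\<And>U. open U \<Longrightarrow> U \<noteq> {} \<Longrightarrow> \<exists>d\<in>D. d \<in> U"
    using countable_dense_setE by blast
  have ae: "AE \<omega> in P. \<forall>d\<in>D. inner d (b \<omega>) = r d * inner w (b \<omega>)"
    using D(1) r by (simp add: AE_ball_countable)
  have "\<exists>\<omega>0. (\<forall>d\<in>D. inner d (b \<omega>0) = r d * inner w (b \<omega>0)) \<and> inner w (b \<omega>0) \<noteq> 0"
  proof (rule ccontr)
    assume *: "\<not> ?thesis"
    have "AE \<omega> in P. inner w (b \<omega>) = 0"
      using ae by eventually_elim (use * in blast)
    with nz show False ..
  qed
  then obtain \<omega>0 where \<omega>0: "\<forall>d\<in>D. inner d (b \<omega>0) = r d * inner w (b \<omega>0)" "inner w (b \<omega>0) \<noteq> 0"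
    by blast
  have "AE \<omega> in P. \<forall>v. inner v (b \<omega>0) = 0 \<longrightarrow> inner v (b \<omega>) = 0"
    using ae
  proof eventually_elim
    case (elim \<omega>)
    \<comment> \<open>\<open>y = 0\<close> makes \<open>b \<omega>\<close> proportional to
      \<open>b \<omega>0\<close>. For \<open>d\<close> in \<open>D\<close> both terms of
      \<open>inner d y\<close> are \<open>r d\<close> times the same product, so they cancel; were
      \<open>y\<close> nonzero, the open half space \<open>0 < inner v y\<close> would meet
      \<open>D\<close>.\<close>
    define y where "y = inner w (b \<omega>0) *\<^sub>R b \<omega> - inner w (b \<omega>) *\<^sub>R b \<omega>0"
    have orth: "inner d y = 0" if "d \<in> D" for d
      using that elim \<omega>0(1) by (simp add: y_def inner_simps)
    have "y = 0"
    proof (rule ccontr)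
      assume "y \<noteq> 0"
      have "open {v. 0 < inner v y}"
        by (intro open_Collect_less continuous_intros)
      moreover have "y \<in> {v. 0 < inner v y}"
        using \<open>y \<noteq> 0\<close> by simp
      ultimately obtain d where "d \<in> D" "0 < inner d y"
        using D(2)[of "{v. 0 < inner v y}"] by blast
      with orth show False by simp
    qed
    show ?case
    proof (intro allI impI)
      fix v assume "inner v (b \<omega>0) = 0"
      moreover have "inner v y = 0" by (simp add: \<open>y = 0\<close>)
      ultimately show "inner v (b \<omega>) = 0"
        using \<omega>0(2) by (simp add: y_def inner_simps)
    qed
  qed
  then show ?thesis by blast
qed

section \<open>Directions in which the law of \<open>X\<close> is nondegenerate\<close>

lemma ext_variance_inner_pos_imp_not_AE_0:
  fixes X :: "'p \<Rightarrow> 'h::{real_inner, second_countable_topology}"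
  assumes "prob_space P" and [measurable]: "X \<in> borel_measurable P"
    and "ext_variance P (\<lambda>\<omega>. inner w (X \<omega>)) > 0"
  shows "\<not> (AE \<omega> in P. inner w (m - X \<omega>) = 0)"
proof
  assume "AE \<omega> in P. inner w (m - X \<omega>) = 0"
  then have "AE \<omega> in P. inner w (X \<omega>) = inner w m"
    by eventually_elim (simp add: inner_diff_right)
  moreover have "\<not> (\<exists>c. AE \<omega> in P. inner w (X \<omega>) = c)"
    using assms by (subst (asm) ext_variance_pos_iff) auto
  ultimately show False by blast
qed

text \<open>These two directions make a weighted second moment of \<open>m - X\<close> positive
  definite on their span. If every \<open>d\<close> had a degenerate correction
  \<open>d + r *\<^sub>R w\<close>, then \<open>AE_collinearI\<close> would put \<open>m - X\<close>
  almost surely on the line through some \<open>g\<close>, and the direction orthogonal to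
  \<open>g\<close> given by \<open>not_on_line\<close> would contradict this.\<close>

lemma not_on_line_independent_directions:
  fixes X :: "'p \<Rightarrow> 'h::{real_inner, second_countable_topology}"
  assumes P: "prob_space P" "X \<in> borel_measurable P" and line: "not_on_line P X"
  obtains w d where "\<not> (AE \<omega> in P. inner w (m - X \<omega>) = 0)"
    and "\<And>r. \<not> (AE \<omega> in P. inner (d + r *\<^sub>R w) (m - X \<omega>) = 0)"
proof -
  obtain w where w: "\<not> (AE \<omega> in P. inner w (m - X \<omega>) = 0)"
    using line ext_variance_inner_pos_imp_not_AE_0[OF P] unfolding not_on_line_def by blast
  have "\<exists>d. \<forall>r. \<not> (AE \<omega> in P. inner (d + r *\<^sub>R w) (m - X \<omega>) = 0)"
  proof (rule ccontr)
    assume "\<not> ?thesis"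
    then have *: "\<exists>r. AE \<omega> in P. inner (d + r *\<^sub>R w) (m - X \<omega>) = 0" for d
      by blast
    have "\<exists>r. AE \<omega> in P. inner d (m - X \<omega>) = r * inner w (m - X \<omega>)" for d
    proof -
      obtain r where r: "AE \<omega> in P. inner (d + r *\<^sub>R w) (m - X \<omega>) = 0"
        using * by blast
      have "AE \<omega> in P. inner d (m - X \<omega>) = (- r) * inner w (m - X \<omega>)"
        using r by eventually_elim (simp add: inner_add_left)
      then show ?thesis by blast
    qed
    from AE_collinearI[OF this w] obtain g
      where g: "AE \<omega> in P. \<forall>v. inner v g = 0 \<longrightarrow> inner v (m - X \<omega>) = 0" by blast
    obtain v where v: "inner g v = 0" "ext_variance P (\<lambda>\<omega>. inner v (X \<omega>)) > 0"
      using line unfolding not_on_line_def by blast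
    have "AE \<omega> in P. inner v (m - X \<omega>) = 0"
      using g by eventually_elim (use v(1) in \<open>simp add: inner_commute\<close>)
    then show False
      using ext_variance_inner_pos_imp_not_AE_0[OF P v(2)] by blast
  qed
  with w that show ?thesis by blast
qed

text \<open>Two free parameters always solve the single equation \<open>inner w h = 0\<close>
  nontrivially, so a two-dimensional span serves every \<open>h\<close> with one constant. This
  replaces compactness of the unit sphere, which fails in infinite dimension.\<close>

lemma orthogonal_in_span_bound:
  fixes w1 w2 h :: "'h::real_inner"
  assumes \<beta>: "\<beta> > 0"
  assumes bound: "\<And>s t. \<beta> * (s\<^sup>2 + t\<^sup>2) \<le> Q (s *\<^sub>R w1 + t *\<^sub>R w2)"
    and Q0: "Q 0 = (0::real)"
  shows "\<exists>w. inner w h = 0 \<and> w \<noteq> 0 \<and>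
           \<beta> / (2 * ((norm w1)\<^sup>2 + (norm w2)\<^sup>2)) * (norm w)\<^sup>2 \<le> Q w"
proof -
  have "\<exists>s t. (s, t) \<noteq> (0, 0) \<and> inner (s *\<^sub>R w1 + t *\<^sub>R w2) h = 0"
  proof (cases "inner w1 h = 0")
    case True
    then show ?thesis by (intro exI[of _ 1] exI[of _ 0]) simp
  next
    case False
    then show ?thesis
      by (intro exI[of _ "inner w2 h"] exI[of _ "- inner w1 h"]) (simp add: inner_simps)
  qed
  then obtain s t where st: "(s, t) \<noteq> (0, 0)" "inner (s *\<^sub>R w1 + t *\<^sub>R w2) h = 0" by blast
  define w where "w = s *\<^sub>R w1 + t *\<^sub>R w2"
  define \<kappa> where "\<kappa> = (norm w1)\<^sup>2 + (norm w2)\<^sup>2"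
  have pos: "s\<^sup>2 + t\<^sup>2 > 0"
    using st(1) by (auto simp: sum_power2_gt_zero_iff)
  \<comment> \<open>Positivity of \<open>Q w\<close> together with \<open>Q 0 = 0\<close> excludes
    \<open>w = 0\<close>; linear independence of \<open>w1\<close> and \<open>w2\<close> is thus
    contained in \<open>bound\<close>.\<close>
  then have Qw: "0 < Q w"
    using bound[of s t] \<beta> unfolding w_def by (smt (verit) mult_pos_pos)
  then have "w \<noteq> 0" using Q0 by auto
  have "norm w \<le> \<bar>s\<bar> * norm w1 + \<bar>t\<bar> * norm w2"
    unfolding w_def by (rule norm_triangle_le) simp
  then have "(norm w)\<^sup>2 \<le> (\<bar>s\<bar> * norm w1 + \<bar>t\<bar> * norm w2)\<^sup>2"
    by (rule power_mono) simp
  also have "\<dots> \<le> 2 * ((\<bar>s\<bar> * norm w1)\<^sup>2 + (\<bar>t\<bar> * norm w2)\<^sup>2)"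
    by (smt (verit) power2_diff power2_sum zero_le_power2)
  also have "\<dots> \<le> 2 * \<kappa> * (s\<^sup>2 + t\<^sup>2)"
    by (simp add: \<kappa>_def power_mult_distrib algebra_simps)
  finally have le: "(norm w)\<^sup>2 \<le> 2 * \<kappa> * (s\<^sup>2 + t\<^sup>2)" .
  have "\<kappa> > 0"
    using le \<open>w \<noteq> 0\<close> pos by (smt (verit) mult_nonneg_nonneg mult_nonpos_nonneg zero_less_norm_iff zero_less_power2 norm_eq_zero mult_less_0_iff)
  have "\<beta> / (2 * \<kappa>) * (norm w)\<^sup>2 \<le> \<beta> / (2 * \<kappa>) * (2 * \<kappa> * (s\<^sup>2 + t\<^sup>2))"
    using le \<beta> \<open>\<kappa> > 0\<close> by (intro mult_left_mono) auto
  also have "\<dots> = \<beta> * (s\<^sup>2 + t\<^sup>2)"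
    using \<open>\<kappa> > 0\<close> by simp
  also have "\<dots> \<le> Q w" using bound[of s t] by (simp add: w_def)
  finally show ?thesis
    using st(2) \<open>w \<noteq> 0\<close> unfolding \<kappa>_def w_def by blast
qed

text \<open>Without moments only differences of norms are integrable. Each objective integrand is
  bounded by \<open>norm u\<close>, and \<open>norm (X \<omega>)\<close> cancels when two of them
  are subtracted.\<close>

lemma is_geometric_median_integral_ge:
  fixes X :: "'p \<Rightarrow> 'h::{real_normed_vector, second_countable_topology}"
  assumes "prob_space P" and [measurable]: "X \<in> borel_measurable P"
    and med: "is_geometric_median P X m"
  shows "integrable P (\<lambda>\<omega>. norm (z - X \<omega>) - norm (m - X \<omega>))"
    and "0 \<le> (\<integral>\<omega>. norm (z - X \<omega>) - norm (m - X \<omega>) \<partial>P)"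
proof -
  interpret prob_space P by fact
  have int: "integrable P (\<lambda>\<omega>. norm (X \<omega> - u) - norm (X \<omega>))" for u
  proof (rule integrable_const_bound[where B = "norm u"])
    show "AE \<omega> in P. norm (norm (X \<omega> - u) - norm (X \<omega>)) \<le> norm u"
    proof (rule AE_I2)
      fix \<omega>
      show "norm (norm (X \<omega> - u) - norm (X \<omega>)) \<le> norm u"
        using norm_triangle_ineq3[of "X \<omega> - u" "X \<omega>"] by simp
    qed
  qed simp
  have eq: "norm (z - X \<omega>) - norm (m - X \<omega>) =
      (norm (X \<omega> - z) - norm (X \<omega>)) - (norm (X \<omega> - m) - norm (X \<omega>))" for \<omega>
    by (simp add: norm_minus_commute)
  show "integrable P (\<lambda>\<omega>. norm (z - X \<omega>) - norm (m - X \<omega>))"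
    unfolding eq by (intro Bochner_Integration.integrable_diff int)
  have "(\<integral>\<omega>. norm (X \<omega> - m) - norm (X \<omega>) \<partial>P) \<le> (\<integral>\<omega>. norm (X \<omega> - z) - norm (X \<omega>) \<partial>P)"
    using med unfolding is_geometric_median_def is_arg_min_linorder by blast
  then show "0 \<le> (\<integral>\<omega>. norm (z - X \<omega>) - norm (m - X \<omega>) \<partial>P)"
    unfolding eq by (subst Bochner_Integration.integral_diff) (auto intro: int)
qed

text \<open>Integrating \<open>inner_sgn_ge_norm_diff\<close> with \<open>b = m - X \<omega>\<close>
  leaves a difference of norms, nonnegative in the mean by minimality of \<open>m\<close>, and a
  Gram term. For each \<open>h\<close>, the latter is bounded below through a \<open>w\<close>
  orthogonal to \<open>h\<close>, chosen in a fixed plane on which the form \<open>B\<close> is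
  coercive.\<close>

lemma geometric_median_strongly_monotone:
  fixes X :: "'p \<Rightarrow> 'h::{real_inner, second_countable_topology}"
  assumes P: "prob_space P" and X [measurable]: "X \<in> borel_measurable P"
    and med: "is_geometric_median P X m" and line: "not_on_line P X" and "A > 0"
  obtains c where "c > 0"
    and "\<And>h. norm h \<le> A \<Longrightarrow> c * (norm h)\<^sup>2 \<le> (\<integral>\<omega>. inner h (sgn (m + h - X \<omega>)) \<partial>P)"
proof -
  interpret prob_space P by fact
  \<comment> \<open>The coefficient of the Gram determinant in \<open>inner_sgn_ge_norm_diff\<close>
    for \<open>K = norm b + A\<close>, a bound on \<open>norm (b + h)\<close> uniform in
    \<open>h\<close>. This weight also keeps the form \<open>B\<close> finite when \<open>X\<close>
    has no moments.\<close>
  define \<psi> where "\<psi> = (\<lambda>\<omega>. 1 / (2 * (norm (m - X \<omega>) + A)\<^sup>2 * norm (m - X \<omega>)))"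
  have [measurable]: "\<psi> \<in> borel_measurable P"
    unfolding \<psi>_def by measurable
  have \<psi>0: "0 \<le> \<psi> \<omega>" for \<omega> by (simp add: \<psi>_def)
  have \<psi>_bound: "\<psi> \<omega> * (norm (m - X \<omega>))\<^sup>2 \<le> 1 / (2 * A)" for \<omega>
  proof (cases "m = X \<omega>")
    case False
    define n where "n = norm (m - X \<omega>)"
    have "n > 0" using False by (simp add: n_def)
    have "A * n \<le> (n + A)\<^sup>2"
      using \<open>n > 0\<close> \<open>A > 0\<close> by (simp add: power2_eq_square algebra_simps)
    have "\<psi> \<omega> * n\<^sup>2 = n / (2 * (n + A)\<^sup>2)"
      using \<open>n > 0\<close> by (simp add: \<psi>_def n_def[symmetric] power2_eq_square)
    also have "\<dots> \<le> 1 / (2 * A)"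
      using \<open>n > 0\<close> \<open>A > 0\<close> \<open>A * n \<le> _\<close> by (simp add: divide_simps mult.commute)
    finally show ?thesis by (simp add: n_def)
  qed (use \<open>A > 0\<close> in simp)
  define B where "B = (\<lambda>u w. \<integral>\<omega>. \<psi> \<omega> * (inner u (m - X \<omega>) * inner w (m - X \<omega>)) \<partial>P)"
  have int: "integrable P (\<lambda>\<omega>. \<psi> \<omega> * (inner u (m - X \<omega>) * inner w (m - X \<omega>)))" for u w
  proof (rule integrable_const_bound)
    show "AE \<omega> in P. norm (\<psi> \<omega> * (inner u (m - X \<omega>) * inner w (m - X \<omega>)))
        \<le> norm u * norm w * (1 / (2 * A))"
    proof (rule AE_I2)
      fix \<omega>
      have "norm (\<psi> \<omega> * (inner u (m - X \<omega>) * inner w (m - X \<omega>)))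
          \<le> \<psi> \<omega> * ((norm u * norm (m - X \<omega>)) * (norm w * norm (m - X \<omega>)))"
        unfolding real_norm_def abs_mult abs_of_nonneg[OF \<psi>0]
        by (intro mult_left_mono mult_mono Cauchy_Schwarz_ineq2) (auto simp: \<psi>0)
      also have "\<dots> = norm u * norm w * (\<psi> \<omega> * (norm (m - X \<omega>))\<^sup>2)"
        by (simp add: power2_eq_square)
      also have "\<dots> \<le> norm u * norm w * (1 / (2 * A))"
        by (intro mult_left_mono \<psi>_bound) simp
      finally show "norm (\<psi> \<omega> * (inner u (m - X \<omega>) * inner w (m - X \<omega>)))
          \<le> norm u * norm w * (1 / (2 * A))" .
    qed
  qed measurable
  have B_add: "B (u + v) w = B u w + B v w" for u v w
    unfolding B_def by (subst Bochner_Integration.integral_add[symmetric, OF int int])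
      (simp add: inner_add_left algebra_simps)
  have B_scale: "B (r *\<^sub>R u) w = r * B u w" for r u w
    unfolding B_def by (subst integral_mult_right_zero[symmetric]) (simp add: mult_ac)
  have B_comm: "B u w = B w u" for u w
    by (simp add: B_def mult_ac)
  have B_add_right: "B w (u + v) = B w u + B w v" and B_scale_right: "B w (r *\<^sub>R u) = r * B w u" for r u v w
    by (simp_all only: B_comm[of w] B_add B_scale)
  have B_pos: "0 < B w w" if "\<not> (AE \<omega> in P. inner w (m - X \<omega>) = 0)" for w
  proof (rule ccontr)
    assume "\<not> 0 < B w w"
    moreover have "0 \<le> B w w"
      unfolding B_def by (rule integral_nonneg_AE) (use \<psi>0 in auto)
    ultimately have "B w w = 0" by simp
    then have "AE \<omega> in P. \<psi> \<omega> * (inner w (m - X \<omega>) * inner w (m - X \<omega>)) = 0"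
      unfolding B_def using \<psi>0 by (subst (asm) integral_nonneg_eq_0_iff_AE) (auto intro: int)
    then have "AE \<omega> in P. inner w (m - X \<omega>) = 0"
    proof eventually_elim
      case (elim \<omega>)
      \<comment> \<open>The weight vanishes, by division by zero, only where
        \<open>X \<omega> = m\<close>, and there the inner product is 0 as well.\<close>
      have "\<psi> \<omega> \<noteq> 0" if "m \<noteq> X \<omega>"
        using that \<open>A > 0\<close> by (simp add: \<psi>_def add_nonneg_eq_0_iff)
      then show ?case using elim by (cases "m = X \<omega>") auto
    qed
    with that show False by blast
  qed
  obtain w1 d where w1: "\<not> (AE \<omega> in P. inner w1 (m - X \<omega>) = 0)"
    and d: "\<And>r. \<not> (AE \<omega> in P. inner (d + r *\<^sub>R w1) (m - X \<omega>) = 0)"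
    using not_on_line_independent_directions[OF P X line] by blast
  \<comment> \<open>A Gram-Schmidt step for the form \<open>B\<close>: it becomes diagonal on the
    span of \<open>w1\<close> and \<open>w2\<close>, with coercivity constant the smaller diagonal
    entry.\<close>
  define w2 where "w2 = d + (- (B d w1 / B w1 w1)) *\<^sub>R w1"
  have B1: "0 < B w1 w1" and B2: "0 < B w2 w2"
    using B_pos w1 d unfolding w2_def by blast+
  have B12: "B w2 w1 = 0"
    using B1 by (simp only: w2_def B_add B_scale) simp
  define \<beta> where "\<beta> = min (B w1 w1) (B w2 w2)"
  have \<beta>: "\<beta> > 0" using B1 B2 by (simp add: \<beta>_def)
  have bound: "\<beta> * (s\<^sup>2 + t\<^sup>2) \<le> B (s *\<^sub>R w1 + t *\<^sub>R w2) (s *\<^sub>R w1 + t *\<^sub>R w2)" for s t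
  proof -
    have "B (s *\<^sub>R w1 + t *\<^sub>R w2) (s *\<^sub>R w1 + t *\<^sub>R w2) = s\<^sup>2 * B w1 w1 + t\<^sup>2 * B w2 w2"
      by (simp add: B_add B_scale B_add_right B_scale_right B_comm[of w1 w2] B12 power2_eq_square)
    moreover have "\<beta> * s\<^sup>2 \<le> B w1 w1 * s\<^sup>2" "\<beta> * t\<^sup>2 \<le> B w2 w2 * t\<^sup>2"
      by (intro mult_right_mono; simp add: \<beta>_def)+
    ultimately show ?thesis by (simp add: algebra_simps)
  qed
  define c where "c = \<beta> / (2 * ((norm w1)\<^sup>2 + (norm w2)\<^sup>2))"
  have "w1 \<noteq> 0" using w1 by auto
  then have "c > 0" using \<beta> unfolding c_def
    by (intro divide_pos_pos mult_pos_pos) (auto intro: add_pos_nonneg)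
  moreover have "c * (norm h)\<^sup>2 \<le> (\<integral>\<omega>. inner h (sgn (m + h - X \<omega>)) \<partial>P)" if h: "norm h \<le> A" for h
  proof -
    obtain w where w: "inner w h = 0" "w \<noteq> 0" "c * (norm w)\<^sup>2 \<le> B w w"
      using orthogonal_in_span_bound[where Q = "\<lambda>w. B w w", OF \<beta> bound, of h]
      unfolding c_def by (auto simp: B_def)
    \<comment> \<open>The factor left after dividing \<open>orthogonal_gram_bound\<close> by
      \<open>(norm w)\<^sup>2\<close>; it also converts coercivity in \<open>w\<close> into the
      wanted multiple of \<open>(norm h)\<^sup>2\<close>.\<close>
    define r where "r = (norm h)\<^sup>2 / (norm w)\<^sup>2"
    have int_sgn: "integrable P (\<lambda>\<omega>. inner h (sgn (m + h - X \<omega>)))"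
    proof (rule integrable_const_bound)
      show "AE \<omega> in P. norm (inner h (sgn (m + h - X \<omega>))) \<le> norm h"
      proof (rule AE_I2)
        fix \<omega>
        have "norm (inner h (sgn (m + h - X \<omega>))) \<le> norm h * norm (sgn (m + h - X \<omega>))"
          by (simp add: Cauchy_Schwarz_ineq2)
        also have "\<dots> \<le> norm h * 1"
          by (intro mult_left_mono) (auto simp: norm_sgn)
        finally show "norm (inner h (sgn (m + h - X \<omega>))) \<le> norm h" by simp
      qed
    qed (simp add: sgn_div_norm)
    have le: "(norm (m + h - X \<omega>) - norm (m - X \<omega>)) +
        r * (\<psi> \<omega> * (inner w (m - X \<omega>) * inner w (m - X \<omega>))) \<le> inner h (sgn (m + h - X \<omega>))" for \<omega>
    proof -
      define b where "b = m - X \<omega>"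
      have a: "m + h - X \<omega> = b + h" by (simp add: b_def)
      have K: "norm (b + h) \<le> norm b + A"
        using h norm_triangle_ineq[of b h] by linarith
      have "r * (inner w b)\<^sup>2 \<le> (norm h)\<^sup>2 * (norm b)\<^sup>2 - (inner h b)\<^sup>2"
        using orthogonal_gram_bound[OF w(1), of b] w(2)
        by (simp add: r_def divide_simps mult.commute)
      then have "\<psi> \<omega> * (r * (inner w b)\<^sup>2) \<le> \<psi> \<omega> * ((norm h)\<^sup>2 * (norm b)\<^sup>2 - (inner h b)\<^sup>2)"
        by (rule mult_left_mono) (rule \<psi>0)
      also have "\<dots> = ((norm h)\<^sup>2 * (norm b)\<^sup>2 - (inner h b)\<^sup>2) / (2 * (norm b + A)\<^sup>2 * norm b)"
        by (simp add: \<psi>_def b_def)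
      finally show ?thesis
        using inner_sgn_ge_norm_diff[OF refl K] unfolding a b_def[symmetric]
        by (simp add: power2_eq_square mult_ac)
    qed
    have "c * (norm h)\<^sup>2 = r * (c * (norm w)\<^sup>2)"
      using w(2) by (simp add: r_def)
    also have "\<dots> \<le> r * B w w"
      by (intro mult_left_mono w) (simp add: r_def)
    \<comment> \<open>Minimality of \<open>m\<close> enters here directly, in place of a vanishing
      gradient.\<close>
    also have "\<dots> \<le> (\<integral>\<omega>. norm (m + h - X \<omega>) - norm (m - X \<omega>) \<partial>P) + r * B w w"
      using is_geometric_median_integral_ge(2)[OF P X med] by simp
    also have "\<dots> = (\<integral>\<omega>. (norm (m + h - X \<omega>) - norm (m - X \<omega>)) +
        r * (\<psi> \<omega> * (inner w (m - X \<omega>) * inner w (m - X \<omega>))) \<partial>P)"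
      unfolding B_def using is_geometric_median_integral_ge(1)[OF P X med] int
      by (subst Bochner_Integration.integral_add) auto
    also have "\<dots> \<le> (\<integral>\<omega>. inner h (sgn (m + h - X \<omega>)) \<partial>P)"
      using is_geometric_median_integral_ge(1)[OF P X med] int int_sgn le
      by (intro integral_mono) (auto intro!: Bochner_Integration.integrable_add integrable_mult_right)
    finally show ?thesis .
  qed
  ultimately show ?thesis using that by blast
qed

subsection \<open>One step of the stochastic gradient algorithm\<close>

text \<open>Used to adjoin the starting point to the samples. A finite intersection of events of the
  \<open>X j\<close> is the preimage of one cylinder, so independence of \<open>Y\<close> from the
  whole family splits off the event of \<open>Y\<close>, and the remaining events factor by
  independence of \<open>X\<close>.\<close>

lemma (in prob_space) indep_vars_insert:
  assumes X: "indep_vars N X I" and i: "i \<notin> I" and Y: "random_variable (N i) Y"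
    and indep: "indep_set (sets (vimage_algebra (space M) Y (N i)))
      (sets (vimage_algebra (space M) (\<lambda>\<omega>. \<lambda>j\<in>I. X j \<omega>) (PiM I N)))"
  shows "indep_vars N (X(i := Y)) (insert i I)"
proof -
  have rv: "random_variable (N j) (X j)" if "j \<in> I" for j
    using X that by (auto simp: indep_vars_def2)
  have rvY: "random_variable (N j) ((X(i := Y)) j)" if "j \<in> insert i I" for j
    using that rv Y by auto
  have "indep_sets (\<lambda>j. {(X(i := Y)) j -` B \<inter> space M |B. B \<in> sets (N j)}) (insert i I)"
  proof (rule indep_setsI)
    show "{(X(i := Y)) j -` B \<inter> space M |B. B \<in> sets (N j)} \<subseteq> events" if "j \<in> insert i I" for j
      using measurable_sets[OF rvY[OF that]] by auto
    fix A J assume J: "J \<noteq> {}" "J \<subseteq> insert i I" "finite J"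
      and A: "\<forall>j\<in>J. A j \<in> {(X(i := Y)) j -` B \<inter> space M |B. B \<in> sets (N j)}"
    have ind: "indep_sets (\<lambda>j. {X j -` B \<inter> space M |B. B \<in> sets (N j)}) I"
      using X by (simp add: indep_vars_def2)
    have prod_I: "prob (\<Inter>j\<in>K. A j) = (\<Prod>j\<in>K. prob (A j))" if K: "K \<noteq> {}" "K \<subseteq> J - {i}" for K
    proof (rule indep_setsD[OF ind])
      show "K \<subseteq> I" using K J(2) by auto
      show "finite K" using K J(3) by (auto intro: finite_subset)
      show "\<forall>j\<in>K. A j \<in> {X j -` B \<inter> space M |B. B \<in> sets (N j)}"
      proof
        fix j assume "j \<in> K"
        with K have "j \<in> J" "j \<noteq> i" by auto
        with A[rule_format, of j] show "A j \<in> {X j -` B \<inter> space M |B. B \<in> sets (N j)}"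
          by simp
      qed
    qed (rule K)
    show "prob (\<Inter>j\<in>J. A j) = (\<Prod>j\<in>J. prob (A j))"
    proof (cases "i \<in> J \<and> J - {i} \<noteq> {}")
      case False
      show ?thesis
      proof (cases "i \<in> J")
        case True
        with False have "J = {i}" by auto
        then show ?thesis by simp
      next
        case False
        then have "J \<subseteq> J - {i}" by auto
        then show ?thesis by (rule prod_I[OF J(1)])
      qed
    next
      case True
      define K where "K = J - {i}"
      have K: "J = insert i K" "i \<notin> K" "K \<noteq> {}" "K \<subseteq> I" "finite K"
        using True J unfolding K_def by auto
      obtain Bi where Bi: "Bi \<in> sets (N i)" "A i = Y -` Bi \<inter> space M"
        using A[rule_format, of i] True by auto
      have "\<forall>j\<in>K. \<exists>B. B \<in> sets (N j) \<and> A j = X j -` B \<inter> space M"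
      proof
        fix j assume "j \<in> K"
        with K have "j \<in> J" "j \<noteq> i" by auto
        with A[rule_format, of j] show "\<exists>B. B \<in> sets (N j) \<and> A j = X j -` B \<inter> space M"
          by auto
      qed
      then obtain B where B: "\<And>j. j \<in> K \<Longrightarrow> B j \<in> sets (N j)"
        "\<And>j. j \<in> K \<Longrightarrow> A j = X j -` B j \<inter> space M"
        by metis
      \<comment> \<open>The finitely many coordinate events form one cylinder event of the product
        space.\<close>
      have "(\<Inter>j\<in>K. A j) = (\<lambda>\<omega>. \<lambda>j\<in>I. X j \<omega>) -` prod_emb I N K (\<Pi>\<^sub>E j\<in>K. B j) \<inter> space M"
      proof (rule set_eqI)
        fix \<omega>
        have "(\<lambda>j\<in>I. X j \<omega>) \<in> prod_emb I N K (\<Pi>\<^sub>E j\<in>K. B j) \<longleftrightarrow> (\<forall>j\<in>K. X j \<omega> \<in> B j)"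
          if "\<omega> \<in> space M"
          using K(4) measurable_space[OF rv that] by (auto simp: prod_emb_iff PiE_iff)
        then show "\<omega> \<in> (\<Inter>j\<in>K. A j) \<longleftrightarrow>
            \<omega> \<in> (\<lambda>\<omega>. \<lambda>j\<in>I. X j \<omega>) -` prod_emb I N K (\<Pi>\<^sub>E j\<in>K. B j) \<inter> space M"
          using K(3) B(2) by auto
      qed
      then have "(\<Inter>j\<in>K. A j) \<in> sets (vimage_algebra (space M) (\<lambda>\<omega>. \<lambda>j\<in>I. X j \<omega>) (PiM I N))"
        using K B by (simp only:) (intro in_vimage_algebra sets_PiM_I; auto)
      moreover have "A i \<in> sets (vimage_algebra (space M) Y (N i))"
        using Bi by (simp add: in_vimage_algebra)
      ultimately have "prob (A i \<inter> (\<Inter>j\<in>K. A j)) = prob (A i) * prob (\<Inter>j\<in>K. A j)"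
        using indep by (intro indep_setD)
      then show ?thesis
        using prod_I[OF K(3)] K(2,5) unfolding K(1) by simp
    qed
  qed
  then show ?thesis
    using rvY by (simp add: indep_vars_def2)
qed

text \<open>Disjoint blocks of coordinates are independent; the block of the single index
  \<open>Suc n\<close> is then mapped to its only coordinate.\<close>

lemma (in prob_space) distr_past_Pair_next:
  fixes Y :: "nat \<Rightarrow> 'a \<Rightarrow> 'b"
  assumes Y: "indep_vars (\<lambda>_. L) Y UNIV"
  shows "distr M (PiM {..n} (\<lambda>_. L) \<Otimes>\<^sub>M L) (\<lambda>\<omega>. (\<lambda>i\<in>{..n}. Y i \<omega>, Y (Suc n) \<omega>)) =
    distr M (PiM {..n} (\<lambda>_. L)) (\<lambda>\<omega>. \<lambda>i\<in>{..n}. Y i \<omega>) \<Otimes>\<^sub>M distr M L (Y (Suc n))"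
proof -
  let ?N = "PiM {..n} (\<lambda>_. L)" and ?N' = "PiM {Suc n} (\<lambda>_. L)"
  let ?H = "\<lambda>\<omega>. \<lambda>i\<in>{..n}. Y i \<omega>" and ?W = "\<lambda>\<omega>. \<lambda>i\<in>{Suc n}. Y i \<omega>"
  have rv [measurable]: "Y i \<in> M \<rightarrow>\<^sub>M L" for i
    using Y by (simp add: indep_vars_def2)
  have H [measurable]: "?H \<in> M \<rightarrow>\<^sub>M ?N" and W [measurable]: "?W \<in> M \<rightarrow>\<^sub>M ?N'"
    by (auto intro!: measurable_restrict)
  have p [measurable]: "(\<lambda>y. y (Suc n)) \<in> ?N' \<rightarrow>\<^sub>M L"
    by (rule measurable_component_singleton) simp
  have "indep_var ?N ?H ?N' ?W"
    by (rule indep_var_restrict[OF Y]) auto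
  then have eq: "distr M ?N ?H \<Otimes>\<^sub>M distr M ?N' ?W = distr M (?N \<Otimes>\<^sub>M ?N') (\<lambda>\<omega>. (?H \<omega>, ?W \<omega>))"
    by (simp add: indep_var_distribution_eq)
  interpret Y: prob_space "distr M L (Y (Suc n))" by (rule prob_space_distr) simp
  have next_eq: "distr M L (Y (Suc n)) = distr (distr M ?N' ?W) L (\<lambda>y. y (Suc n))"
    by (simp add: distr_distr comp_def)
  have "distr M ?N ?H \<Otimes>\<^sub>M distr M L (Y (Suc n)) =
      distr (distr M ?N ?H) ?N (\<lambda>y. y) \<Otimes>\<^sub>M distr (distr M ?N' ?W) L (\<lambda>y. y (Suc n))"
    unfolding next_eq by (subst distr_id2) simp_all
  also have "\<dots> = distr (distr M ?N ?H \<Otimes>\<^sub>M distr M ?N' ?W) (?N \<Otimes>\<^sub>M L) (\<lambda>(x, y). (x, y (Suc n)))"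
    by (rule pair_measure_distr) (simp_all flip: next_eq, unfold_locales)
  also have "\<dots> = distr M (?N \<Otimes>\<^sub>M L) (\<lambda>\<omega>. (?H \<omega>, Y (Suc n) \<omega>))"
    unfolding eq by (subst distr_distr) (simp_all add: comp_def)
  finally show ?thesis ..
qed

section \<open>The iterate as a function of its inputs\<close>

text \<open>The value \<open>sgn 0 = 0\<close> absorbs the convention for a sample that hits the
  current iterate.\<close>

lemma median_sgd_Suc_eq_sgn:
  "median_sgd \<gamma> Z0 X (Suc n) \<omega> =
     median_sgd \<gamma> Z0 X n \<omega> + \<gamma> n *\<^sub>R sgn (X (Suc n) \<omega> - median_sgd \<gamma> Z0 X n \<omega>)"
  by (auto simp: Let_def sgn_div_norm divide_inverse)

declare median_sgd.simps(2) [simp del]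

text \<open>The algorithm run on the space of input sequences, with the starting point as coordinate
  0. This exhibits the iterate as a fixed function of the inputs, so measurability and dependence on
  the past can be read off from coordinates.\<close>

abbreviation canonical_sgd :: "(nat \<Rightarrow> real) \<Rightarrow> nat \<Rightarrow> (nat \<Rightarrow> 'h::real_normed_vector) \<Rightarrow> 'h" where
  "canonical_sgd \<gamma> \<equiv> median_sgd \<gamma> (\<lambda>y. y 0) (\<lambda>i y. y i)"

lemma median_sgd_eq_canonical:
  "median_sgd \<gamma> Z0 X n \<omega> = canonical_sgd \<gamma> n (\<lambda>i. (X(0 := Z0)) i \<omega>)"
  by (induction n) (simp_all add: median_sgd_Suc_eq_sgn)

lemma canonical_sgd_restrict:
  "k \<le> n \<Longrightarrow> canonical_sgd \<gamma> k (restrict y {..n}) = canonical_sgd \<gamma> k y"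
  by (induction k) (simp_all add: median_sgd_Suc_eq_sgn)

lemma measurable_canonical_sgd:
  fixes \<gamma> :: "nat \<Rightarrow> real"
  shows "k \<le> n \<Longrightarrow> canonical_sgd \<gamma> k \<in>
    PiM {..n} (\<lambda>_. borel) \<rightarrow>\<^sub>M (borel :: 'h::{real_normed_vector, second_countable_topology} measure)"
proof (induction k)
  case 0
  then show ?case by simp
next
  case (Suc k)
  then have [measurable]: "canonical_sgd \<gamma> k \<in> PiM {..n} (\<lambda>_. borel) \<rightarrow>\<^sub>M (borel :: 'h measure)"
    by simp
  have [measurable]: "(\<lambda>y. y (Suc k)) \<in> PiM {..n} (\<lambda>_. borel) \<rightarrow>\<^sub>M (borel :: 'h measure)"
    using Suc by (intro measurable_component_singleton) simp
  have eq: "canonical_sgd \<gamma> (Suc k) = (\<lambda>y :: nat \<Rightarrow> 'h. canonical_sgd \<gamma> k y +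
      (\<gamma> k / norm (y (Suc k) - canonical_sgd \<gamma> k y)) *\<^sub>R (y (Suc k) - canonical_sgd \<gamma> k y))"
    by (auto simp: fun_eq_iff median_sgd_Suc_eq_sgn sgn_div_norm divide_inverse)
  show ?case unfolding eq by measurable
qed

text \<open>Conditioning on the past by Fubini: since the joint law is a product, \<open>H\<close>
  can be frozen at \<open>s\<close> while \<open>W\<close> is integrated out. The uniform bound
  \<open>B\<close> supplies all integrability.\<close>

lemma (in prob_space) expectation_indep_ge:
  assumes [measurable]: "H \<in> M \<rightarrow>\<^sub>M N" "W \<in> M \<rightarrow>\<^sub>M L"
    and indep: "distr M (N \<Otimes>\<^sub>M L) (\<lambda>\<omega>. (H \<omega>, W \<omega>)) = distr M N H \<Otimes>\<^sub>M distr M L W"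
    and f: "f \<in> borel_measurable (N \<Otimes>\<^sub>M L)" "\<And>s x. \<bar>f (s, x)\<bar> \<le> (B :: real)"
    and g: "g \<in> borel_measurable N" "\<And>s. \<bar>g s\<bar> \<le> B"
    and le: "\<And>s. g s \<le> (\<integral>x. f (s, x) \<partial>distr M L W)"
  shows "(\<integral>\<omega>. g (H \<omega>) \<partial>M) \<le> (\<integral>\<omega>. f (H \<omega>, W \<omega>) \<partial>M)"
proof -
  note [measurable] = f(1) g(1)
  interpret H: prob_space "distr M N H" by (rule prob_space_distr) simp
  interpret W: prob_space "distr M L W" by (rule prob_space_distr) simp
  interpret HW: pair_prob_space "distr M N H" "distr M L W" ..
  have int: "integrable (distr M N H \<Otimes>\<^sub>M distr M L W) f"
    by (rule HW.integrable_const_bound[where B = B]) (use f(2) in \<open>auto\<close>)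
  have "(\<integral>\<omega>. g (H \<omega>) \<partial>M) = (\<integral>s. g s \<partial>distr M N H)"
    by (rule integral_distr[symmetric]) simp_all
  also have "\<dots> \<le> (\<integral>s. (\<integral>x. f (s, x) \<partial>distr M L W) \<partial>distr M N H)"
  proof (rule integral_mono)
    show "integrable (distr M N H) g"
      by (rule H.integrable_const_bound[where B = B]) (use g(2) in auto)
    show "integrable (distr M N H) (\<lambda>s. \<integral>x. f (s, x) \<partial>distr M L W)"
      by (rule HW.integrable_fst'[OF int])
  qed (rule le)
  also have "\<dots> = (\<integral>p. f p \<partial>(distr M N H \<Otimes>\<^sub>M distr M L W))"
    by (rule HW.integral_fst'[OF int])
  also have "\<dots> = (\<integral>\<omega>. f (H \<omega>, W \<omega>) \<partial>M)"
    unfolding indep[symmetric] by (rule integral_distr) simp_all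
  finally show ?thesis .
qed

text \<open>Expanding the square of \<open>h - g *\<^sub>R u\<close> with
  \<open>norm u \<le> 1\<close> costs at most \<open>g\<^sup>2\<close>. The cross term is bounded by
  \<open>mono\<close> for each frozen past, and restriction to \<open>D\<close> keeps
  \<open>h\<close> in the ball where \<open>mono\<close> holds.\<close>

lemma (in prob_space) expectation_sgd_step_le:
  fixes W :: "'a \<Rightarrow> 'h::{real_inner, second_countable_topology}" and z :: "'b \<Rightarrow> 'h"
  assumes meas [measurable]: "H \<in> M \<rightarrow>\<^sub>M N" "W \<in> M \<rightarrow>\<^sub>M borel"
    and indep: "distr M (N \<Otimes>\<^sub>M borel) (\<lambda>\<omega>. (H \<omega>, W \<omega>)) = distr M N H \<Otimes>\<^sub>M distr M borel W"
    and z [measurable]: "z \<in> borel_measurable N" and D [measurable]: "D \<in> sets N"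
    and "0 \<le> A" and bounded: "\<And>s. s \<in> D \<Longrightarrow> norm (z s - m) \<le> A"
    and mono: "\<And>h. norm h \<le> A \<Longrightarrow> c * (norm h)\<^sup>2 \<le> (\<integral>x. inner h (sgn (m + h - x)) \<partial>distr M borel W)"
    and "0 \<le> c" "0 \<le> g"
  shows "(\<integral>\<omega>. indicator D (H \<omega>) * (norm (z (H \<omega>) + g *\<^sub>R sgn (W \<omega> - z (H \<omega>)) - m))\<^sup>2 \<partial>M)
    \<le> (1 - 2 * g * c) * (\<integral>\<omega>. indicator D (H \<omega>) * (norm (z (H \<omega>) - m))\<^sup>2 \<partial>M) + g\<^sup>2"
proof -
  have sgn_meas [measurable]: "(sgn :: 'h \<Rightarrow> 'h) \<in> borel_measurable borel"
    unfolding sgn_div_norm by measurable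
  define f where "f = (\<lambda>(s, x). indicator D s * inner (z s - m) (sgn (z s - x)))"
  define V where "V = (\<lambda>s. indicator D s * (norm (z s - m))\<^sup>2)"
  have [measurable]: "f \<in> borel_measurable (N \<Otimes>\<^sub>M borel)" "V \<in> borel_measurable N"
    unfolding f_def V_def by measurable
  have f_bound: "\<bar>f (s, x)\<bar> \<le> A" for s x
  proof (cases "s \<in> D")
    case True
    have "\<bar>inner (z s - m) (sgn (z s - x))\<bar> \<le> norm (z s - m) * norm (sgn (z s - x))"
      by (rule Cauchy_Schwarz_ineq2)
    also have "\<dots> \<le> A * 1"
      using bounded[OF True] \<open>0 \<le> A\<close> by (intro mult_mono) (auto simp: norm_sgn)
    finally show ?thesis using True by (simp add: f_def)
  qed (use \<open>0 \<le> A\<close> in \<open>simp add: f_def\<close>)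
  have V_bound: "\<bar>V s\<bar> \<le> A\<^sup>2" for s
    using bounded[of s] by (auto simp: V_def indicator_def intro!: power_mono)
  have intV: "integrable M (\<lambda>\<omega>. V (H \<omega>))"
    by (rule integrable_const_bound[where B = "A\<^sup>2"]) (use V_bound in auto)
  have intf: "integrable M (\<lambda>\<omega>. f (H \<omega>, W \<omega>))"
    by (rule integrable_const_bound[where B = A]) (use f_bound in auto)
  have drift: "c * (\<integral>\<omega>. V (H \<omega>) \<partial>M) \<le> (\<integral>\<omega>. f (H \<omega>, W \<omega>) \<partial>M)"
  proof -
    have "(\<integral>\<omega>. c * V (H \<omega>) \<partial>M) \<le> (\<integral>\<omega>. f (H \<omega>, W \<omega>) \<partial>M)"
    proof (rule expectation_indep_ge[OF meas indep, where B = "max A (c * A\<^sup>2)"])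
      show "\<bar>c * V s\<bar> \<le> max A (c * A\<^sup>2)" for s
        using mult_left_mono[OF V_bound[of s] \<open>0 \<le> c\<close>] \<open>0 \<le> c\<close> by (simp add: abs_mult)
      show "\<bar>f (s, x)\<bar> \<le> max A (c * A\<^sup>2)" for s x
        using f_bound[of s x] by simp
      show "c * V s \<le> (\<integral>x. f (s, x) \<partial>distr M borel W)" for s
        using mono[of "z s - m"] bounded[of s] by (simp add: V_def f_def indicator_def)
    qed simp_all
    then show ?thesis by simp
  qed
  have step: "indicator D (H \<omega>) * (norm (z (H \<omega>) + g *\<^sub>R sgn (W \<omega> - z (H \<omega>)) - m))\<^sup>2
      \<le> V (H \<omega>) - 2 * g * f (H \<omega>, W \<omega>) + g\<^sup>2" for \<omega>
  proof -
    define h u where "h = z (H \<omega>) - m" and "u = sgn (z (H \<omega>) - W \<omega>)"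
    have u: "sgn (W \<omega> - z (H \<omega>)) = - u"
      unfolding u_def by (simp flip: sgn_minus)
    have "(norm u)\<^sup>2 \<le> 1" by (simp add: u_def norm_sgn)
    then have "g\<^sup>2 * (norm u)\<^sup>2 \<le> g\<^sup>2"
      using mult_left_mono[of "(norm u)\<^sup>2" 1 "g\<^sup>2"] by simp
    moreover have "(norm (h - g *\<^sub>R u))\<^sup>2 = (norm h)\<^sup>2 - 2 * g * inner h u + g\<^sup>2 * (norm u)\<^sup>2"
      unfolding power2_norm_eq_inner
      by (simp add: inner_diff_left inner_diff_right inner_commute[of u h] power2_eq_square algebra_simps)
    ultimately have "(norm (h - g *\<^sub>R u))\<^sup>2 \<le> (norm h)\<^sup>2 - 2 * g * inner h u + g\<^sup>2"
      by simp
    moreover have "z (H \<omega>) + g *\<^sub>R sgn (W \<omega> - z (H \<omega>)) - m = h - g *\<^sub>R u"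
      unfolding u by (simp add: h_def)
    ultimately have "(norm (z (H \<omega>) + g *\<^sub>R sgn (W \<omega> - z (H \<omega>)) - m))\<^sup>2
        \<le> (norm h)\<^sup>2 - 2 * g * inner h u + g\<^sup>2"
      by simp
    then show ?thesis
      by (simp add: V_def f_def indicator_def flip: h_def u_def)
  qed
  have "(\<integral>\<omega>. indicator D (H \<omega>) * (norm (z (H \<omega>) + g *\<^sub>R sgn (W \<omega> - z (H \<omega>)) - m))\<^sup>2 \<partial>M)
      \<le> (\<integral>\<omega>. V (H \<omega>) - 2 * g * f (H \<omega>, W \<omega>) + g\<^sup>2 \<partial>M)"
  proof (rule integral_mono')
    show "integrable M (\<lambda>\<omega>. V (H \<omega>) - 2 * g * f (H \<omega>, W \<omega>) + g\<^sup>2)"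
      using intV intf by simp
    show "0 \<le> V (H \<omega>) - 2 * g * f (H \<omega>, W \<omega>) + g\<^sup>2" for \<omega>
      by (rule order_trans[OF _ step]) simp
  qed (rule step)
  also have "\<dots> = (\<integral>\<omega>. V (H \<omega>) \<partial>M) - 2 * g * (\<integral>\<omega>. f (H \<omega>, W \<omega>) \<partial>M) + g\<^sup>2"
    using intV intf by (simp add: prob_space)
  also have "\<dots> \<le> (\<integral>\<omega>. V (H \<omega>) \<partial>M) - 2 * g * (c * (\<integral>\<omega>. V (H \<omega>) \<partial>M)) + g\<^sup>2"
    using drift \<open>0 \<le> g\<close> by (simp add: mult_left_mono)
  finally show ?thesis by (simp add: V_def algebra_simps)
qed

subsection \<open>Asymptotics of the recursion\<close>

text \<open>Multiples of \<open>real n powr -\<alpha>\<close> are eventually supersolutions. Half of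
  the contraction \<open>b\<close> absorbs the term with \<open>q\<close>; the other half absorbs
  the decrease of \<open>real n powr -\<alpha>\<close>, which is of order
  \<open>real n powr (-\<alpha> - 1)\<close> and hence negligible against
  \<open>real n powr (- 2 * \<alpha>)\<close> because \<alpha> < 1.\<close>

lemma powr_recursion_bound:
  fixes e :: "nat \<Rightarrow> real"
  assumes "0 < b" "0 < \<alpha>" "\<alpha> < 1"
    and rec: "\<forall>\<^sub>F n in sequentially. e (Suc n) \<le> (1 - b * real n powr -\<alpha>) * e n + q * real n powr (- 2 * \<alpha>)"
  shows "\<exists>K\<ge>0. \<forall>\<^sub>F n in sequentially. e n \<le> K * real n powr -\<alpha>"
proof -
  have 1: "\<forall>\<^sub>F n in sequentially. real n powr -\<alpha> - real (Suc n) powr -\<alpha> \<le> (b / 2) * real n powr (- 2 * \<alpha>)"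
    using assms(1-3) by real_asymp
  have 2: "\<forall>\<^sub>F n in sequentially. b * real n powr -\<alpha> \<le> 1"
    using assms(1-3) by real_asymp
  obtain n0 where n0: "\<And>n. n \<ge> n0 \<Longrightarrow>
      e (Suc n) \<le> (1 - b * real n powr -\<alpha>) * e n + q * real n powr (- 2 * \<alpha>)"
    "\<And>n. n \<ge> n0 \<Longrightarrow> real n powr -\<alpha> - real (Suc n) powr -\<alpha> \<le> (b / 2) * real n powr (- 2 * \<alpha>)"
    "\<And>n. n \<ge> n0 \<Longrightarrow> b * real n powr -\<alpha> \<le> 1" "n0 > 0"
    using eventually_conj[OF rec eventually_conj[OF 1 eventually_conj[OF 2 eventually_gt_at_top[of 0]]]]
    unfolding eventually_sequentially by (metis le_refl)
  \<comment> \<open>The first entry gives \<open>q \<le> b / 2 * K\<close> for the induction step,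
    the second starts the induction at \<open>n0\<close>.\<close>
  define K where "K = max (2 * \<bar>q\<bar> / b) (\<bar>e n0\<bar> * real n0 powr \<alpha>)"
  have Kq: "2 * \<bar>q\<bar> / b \<le> K" and K0: "\<bar>e n0\<bar> * real n0 powr \<alpha> \<le> K"
    by (simp_all add: K_def)
  have "0 \<le> K" using K0 by (rule order_trans[rotated]) simp
  have "e n \<le> K * real n powr -\<alpha>" if "n \<ge> n0" for n
    using that
  proof (induction n rule: dec_induct)
    case base
    have "e n0 \<le> (\<bar>e n0\<bar> * real n0 powr \<alpha>) * real n0 powr -\<alpha>"
      using n0(4) by (simp add: powr_minus field_simps)
    also have "\<dots> \<le> K * real n0 powr -\<alpha>"
      using K0 by (rule mult_right_mono) simp
    finally show ?case .
  next
    case (step n)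
    define u where "u = real n powr -\<alpha>"
    have u2: "real n powr (- 2 * \<alpha>) = u * u"
      unfolding u_def by (simp flip: powr_add)
    have "e (Suc n) \<le> (1 - b * u) * e n + q * (u * u)"
      using n0(1)[OF step(1)] unfolding u2 u_def[symmetric] .
    also have "(1 - b * u) * e n \<le> (1 - b * u) * (K * u)"
      using step(3) n0(3)[OF step(1)] by (intro mult_left_mono) (auto simp: u_def)
    also have "q * (u * u) \<le> (b / 2 * K) * (u * u)"
      using Kq \<open>0 < b\<close> by (intro mult_right_mono) (auto simp: field_simps)
    also have "(1 - b * u) * (K * u) + (b / 2 * K) * (u * u) = K * (u - b / 2 * (u * u))"
      by (simp add: algebra_simps)
    also have "\<dots> \<le> K * real (Suc n) powr -\<alpha>"
      using n0(2)[OF step(1)] \<open>0 \<le> K\<close> unfolding u2 u_def[symmetric] by (intro mult_left_mono) auto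
    finally show ?case by simp
  qed
  then show ?thesis
    using \<open>0 \<le> K\<close> unfolding eventually_sequentially by blast
qed

text \<open>Every summand is at least the last one, so the sum grows at least like
  \<open>real n powr (1 - \<alpha>)\<close>. The logarithm in the target bound can therefore be
  inserted for free.\<close>

lemma eventually_ln_sum_powr_ge_1:
  fixes c \<alpha> :: real
  assumes "0 < c" "\<alpha> < 1" and \<alpha>: "0 < \<alpha>"
  shows "\<forall>\<^sub>F n in sequentially. 1 \<le> ln (\<Sum>k = 1..n. c * real k powr -\<alpha>)"
proof -
  have "\<forall>\<^sub>F n in sequentially. exp 1 \<le> real n * (c * real n powr -\<alpha>)"
    using assms by real_asymp
  then show ?thesis
  proof eventually_elim
    case (elim n)
    have "real n * (c * real n powr -\<alpha>) = (\<Sum>k = 1..n. c * real n powr -\<alpha>)"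
      by simp
    also have "\<dots> \<le> (\<Sum>k = 1..n. c * real k powr -\<alpha>)"
      using assms by (intro sum_mono mult_left_mono powr_mono2') auto
    finally have le: "exp 1 \<le> (\<Sum>k = 1..n. c * real k powr -\<alpha>)"
      using elim by simp
    have "ln (exp 1) \<le> ln (\<Sum>k = 1..n. c * real k powr -\<alpha>)"
      using le by (intro ln_mono) (auto intro: less_le_trans[OF exp_gt_zero])
    then show ?case by simp
  qed
qed

lemma summable_power2_steps:
  fixes \<gamma> :: "nat \<Rightarrow> real"
  assumes "1 / 2 < \<alpha>" and \<gamma>: "\<And>n. n \<ge> 1 \<Longrightarrow> \<gamma> n = c * real n powr -\<alpha>"
  shows "summable (\<lambda>n. (\<gamma> n)\<^sup>2)"
proof -
  have "summable (\<lambda>n. real n powr (- 2 * \<alpha>))"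
    using assms by (simp add: summable_real_powr_iff)
  then have "summable (\<lambda>n. c\<^sup>2 * real n powr (- 2 * \<alpha>))"
    by (rule summable_mult)
  then show ?thesis
  proof (rule summable_cong[THEN iffD1, rotated])
    show "\<forall>\<^sub>F n in sequentially. c\<^sup>2 * real n powr (- 2 * \<alpha>) = (\<gamma> n)\<^sup>2"
      using eventually_ge_at_top[of 1]
      by eventually_elim (simp add: \<gamma> power_mult_distrib power2_eq_square flip: powr_add)
  qed
qed

subsection \<open>Localization\<close>

text \<open>\<open>Y 0\<close> is the starting point and \<open>Y (Suc n)\<close> are the samples,
  so that one family carries all the independence. Plain monotonicity suffices to confine
  trajectories; strong monotonicity depends on the radius and enters only in the lemmas that fix
  one.\<close>

locale localized_sgd = prob_space M for M :: "'o measure" +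
  fixes Y :: "nat \<Rightarrow> 'o \<Rightarrow> 'h::{real_inner, second_countable_topology}"
    and \<gamma> :: "nat \<Rightarrow> real" and m :: 'h and \<mu> :: "'h measure"
  assumes indep: "indep_vars (\<lambda>_. borel) Y UNIV"
    and distr_Y: "\<And>n. distr M borel (Y (Suc n)) = \<mu>"
    and \<gamma>_nonneg: "\<And>n. 0 \<le> \<gamma> n"
    and monotone: "\<And>h. 0 \<le> (\<integral>x. inner h (sgn (m + h - x)) \<partial>\<mu>)"
begin

definition iterate :: "nat \<Rightarrow> 'o \<Rightarrow> 'h" where
  "iterate n \<omega> = canonical_sgd \<gamma> n (\<lambda>i. Y i \<omega>)"

definition stay :: "real \<Rightarrow> nat \<Rightarrow> 'o set" where
  "stay R n = {\<omega> \<in> space M. \<forall>k\<le>n. norm (iterate k \<omega> - m) \<le> R}"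

text \<open>The indicator looks only up to time \<open>n\<close>, so it is a function of the past
  and independent of the next sample; the event of never leaving the ball would not be.\<close>

definition err :: "real \<Rightarrow> nat \<Rightarrow> real" where
  "err R n = (\<integral>\<omega>. indicator (stay R n) \<omega> * (norm (iterate n \<omega> - m))\<^sup>2 \<partial>M)"

lemma iterate_Suc: "iterate (Suc n) \<omega> = iterate n \<omega> + \<gamma> n *\<^sub>R sgn (Y (Suc n) \<omega> - iterate n \<omega>)"
  unfolding iterate_def by (rule median_sgd_Suc_eq_sgn)

lemma random_variable_Y [measurable]: "Y n \<in> borel_measurable M"
  using indep by (simp add: indep_vars_def2)

lemma measurable_past [measurable]: "(\<lambda>\<omega>. \<lambda>i\<in>{..n}. Y i \<omega>) \<in> M \<rightarrow>\<^sub>M PiM {..n} (\<lambda>_. borel)"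
  by (intro measurable_restrict) simp

lemma iterate_eq_past: "k \<le> n \<Longrightarrow> iterate k \<omega> = canonical_sgd \<gamma> k (\<lambda>i\<in>{..n}. Y i \<omega>)"
  by (simp add: iterate_def canonical_sgd_restrict)

lemma random_variable_iterate [measurable]: "iterate n \<in> borel_measurable M"
proof -
  have "iterate n = (\<lambda>\<omega>. canonical_sgd \<gamma> n (\<lambda>i\<in>{..n}. Y i \<omega>))"
    using iterate_eq_past by blast
  then show ?thesis
    using measurable_compose[OF measurable_past measurable_canonical_sgd[of n n \<gamma>]] by simp
qed

lemma sets_stay [measurable]: "stay R n \<in> sets M"
  unfolding stay_def by measurable

lemma decseq_stay: "decseq (stay R)"
  by (rule decseq_SucI) (auto simp: stay_def)

lemma stay_mono: "R \<le> R' \<Longrightarrow> stay R n \<subseteq> stay R' n"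
  unfolding stay_def by force

lemma norm_le_of_stay: "\<omega> \<in> stay R n \<Longrightarrow> norm (iterate n \<omega> - m) \<le> R"
  by (simp add: stay_def)

lemma integrable_err:
  "integrable M (\<lambda>\<omega>. indicator (stay R n) \<omega> * (norm (iterate n \<omega> - m))\<^sup>2)"
  by (rule integrable_const_bound[where B = "R\<^sup>2"])
    (auto simp: indicator_def intro!: power_mono dest: norm_le_of_stay)

text \<open>A trajectory leaving at time \<open>Suc n\<close> is then at distance at least
  \<open>R\<close>, so its share of the one-step bound pays for \<open>R\<^sup>2\<close> times the
  exit probability. Dropping that term yields the rate; keeping it with \<open>c = 0\<close> yields
  the maximal inequality.\<close>

lemma err_Suc_le:
  assumes "0 \<le> R" "0 \<le> c"
    and mono: "\<And>h. norm h \<le> R \<Longrightarrow> c * (norm h)\<^sup>2 \<le> (\<integral>x. inner h (sgn (m + h - x)) \<partial>\<mu>)"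
  shows "err R (Suc n) + R\<^sup>2 * prob (stay R n - stay R (Suc n))
    \<le> (1 - 2 * \<gamma> n * c) * err R n + (\<gamma> n)\<^sup>2"
proof -
  let ?N = "PiM {..n} (\<lambda>_. borel :: 'h measure)" and ?H = "\<lambda>\<omega>. \<lambda>i\<in>{..n}. Y i \<omega>"
  \<comment> \<open>The event \<open>stay R n\<close> transported to the space of pasts, where
    \<open>expectation_sgd_step_le\<close> expects it.\<close>
  define D where "D = {y \<in> space ?N. \<forall>k\<in>{..n}. norm (canonical_sgd \<gamma> k y - m) \<le> R}"
  have D: "D \<in> sets ?N"
  proof -
    have "{y \<in> space ?N. norm (canonical_sgd \<gamma> k y - m) \<le> R} \<in> sets ?N" if "k \<in> {..n}" for k
    proof -
      have [measurable]: "canonical_sgd \<gamma> k \<in> ?N \<rightarrow>\<^sub>M (borel :: 'h measure)"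
        using that by (intro measurable_canonical_sgd) simp
      show ?thesis by measurable
    qed
    then show ?thesis
      unfolding D_def by (intro sets.sets_Collect_finite_All) auto
  qed
  have ind: "indicator D (?H \<omega>) = (indicator (stay R n) \<omega> :: real)" if "\<omega> \<in> space M" for \<omega>
    using that measurable_space[OF measurable_past that, of n]
    by (auto simp: D_def stay_def indicator_def iterate_eq_past[of _ n])
  have "(\<integral>\<omega>. indicator D (?H \<omega>) * (norm (canonical_sgd \<gamma> n (?H \<omega>) +
        \<gamma> n *\<^sub>R sgn (Y (Suc n) \<omega> - canonical_sgd \<gamma> n (?H \<omega>)) - m))\<^sup>2 \<partial>M)
      \<le> (1 - 2 * \<gamma> n * c) *
        (\<integral>\<omega>. indicator D (?H \<omega>) * (norm (canonical_sgd \<gamma> n (?H \<omega>) - m))\<^sup>2 \<partial>M) + (\<gamma> n)\<^sup>2"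
    by (rule expectation_sgd_step_le[OF measurable_past random_variable_Y distr_past_Pair_next[OF indep]
          measurable_canonical_sgd D \<open>0 \<le> R\<close>])
      (use mono \<open>0 \<le> c\<close> \<gamma>_nonneg in \<open>auto simp: distr_Y D_def\<close>)
  also have "(\<integral>\<omega>. indicator D (?H \<omega>) * (norm (canonical_sgd \<gamma> n (?H \<omega>) - m))\<^sup>2 \<partial>M) = err R n"
    unfolding err_def
    by (rule Bochner_Integration.integral_cong) (simp_all add: ind iterate_eq_past[of n n])
  also have "(\<integral>\<omega>. indicator D (?H \<omega>) * (norm (canonical_sgd \<gamma> n (?H \<omega>) +
        \<gamma> n *\<^sub>R sgn (Y (Suc n) \<omega> - canonical_sgd \<gamma> n (?H \<omega>)) - m))\<^sup>2 \<partial>M) =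
      (\<integral>\<omega>. indicator (stay R n) \<omega> * (norm (iterate (Suc n) \<omega> - m))\<^sup>2 \<partial>M)"
    by (rule Bochner_Integration.integral_cong) (simp_all add: ind iterate_Suc iterate_eq_past[of n n])
  finally have le: "(\<integral>\<omega>. indicator (stay R n) \<omega> * (norm (iterate (Suc n) \<omega> - m))\<^sup>2 \<partial>M)
      \<le> (1 - 2 * \<gamma> n * c) * err R n + (\<gamma> n)\<^sup>2" .
  have bound: "norm (iterate (Suc n) \<omega> - m) \<le> R + \<gamma> n" if "\<omega> \<in> stay R n" for \<omega>
  proof -
    have "norm (iterate (Suc n) \<omega> - m) \<le> norm (iterate n \<omega> - m) + norm (\<gamma> n *\<^sub>R sgn (Y (Suc n) \<omega> - iterate n \<omega>))"
      unfolding iterate_Suc by (metis add_diff_eq add.commute norm_triangle_ineq)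
    also have "\<dots> \<le> R + \<gamma> n"
      using norm_le_of_stay[OF that] \<gamma>_nonneg[of n] by (intro add_mono) (auto simp: norm_sgn)
    finally show ?thesis .
  qed
  have int_exit: "integrable M (\<lambda>\<omega>. R\<^sup>2 * indicator (stay R n - stay R (Suc n)) \<omega> :: real)"
    by (intro integrable_mult_right integrable_real_indicator) (auto simp: emeasure_eq_measure)
  have "err R (Suc n) + R\<^sup>2 * prob (stay R n - stay R (Suc n)) =
      (\<integral>\<omega>. indicator (stay R (Suc n)) \<omega> * (norm (iterate (Suc n) \<omega> - m))\<^sup>2 +
        R\<^sup>2 * indicator (stay R n - stay R (Suc n)) \<omega> \<partial>M)"
    unfolding err_def by (subst Bochner_Integration.integral_add[OF integrable_err int_exit]) simp
  also have "\<dots> \<le> (\<integral>\<omega>. indicator (stay R n) \<omega> * (norm (iterate (Suc n) \<omega> - m))\<^sup>2 \<partial>M)"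
  proof (rule integral_mono)
    show "integrable M (\<lambda>\<omega>. indicator (stay R n) \<omega> * (norm (iterate (Suc n) \<omega> - m))\<^sup>2)"
      by (rule integrable_const_bound[where B = "(R + \<gamma> n)\<^sup>2"])
        (auto simp: indicator_def intro!: power_mono bound)
    fix \<omega> assume "\<omega> \<in> space M"
    consider "\<omega> \<in> stay R (Suc n)" "\<omega> \<in> stay R n" | "\<omega> \<in> stay R n" "\<omega> \<notin> stay R (Suc n)"
      | "\<omega> \<notin> stay R n" "\<omega> \<notin> stay R (Suc n)"
      using decseq_stay[of R] decseqD[of "stay R" n "Suc n"] by auto
    then show "indicator (stay R (Suc n)) \<omega> * (norm (iterate (Suc n) \<omega> - m))\<^sup>2 +
        R\<^sup>2 * indicator (stay R n - stay R (Suc n)) \<omega>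
        \<le> indicator (stay R n) \<omega> * (norm (iterate (Suc n) \<omega> - m))\<^sup>2"
    proof cases
      case 2
      then have "R \<le> norm (iterate (Suc n) \<omega> - m)"
        by (auto simp: stay_def le_Suc_eq)
      then have "R\<^sup>2 \<le> (norm (iterate (Suc n) \<omega> - m))\<^sup>2"
        using \<open>0 \<le> R\<close> by (rule power_mono)
      with 2 show ?thesis by simp
    qed simp_all
  qed (intro Bochner_Integration.integrable_add integrable_err int_exit)
  finally show ?thesis using le by simp
qed

text \<open>Doob's maximal inequality for the nonnegative supermartingale
  \<open>\<parallel>Z\<^sub>n - m\<parallel>\<^sup>2 + \<Sum>\<^bsub>k \<ge> n\<^esub> \<gamma>\<^sub>k\<^sup>2\<close>, by induction on the finite horizon.\<close>

lemma prob_exit_le: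
  assumes init: "AE \<omega> in M. norm (Y 0 \<omega> - m) \<le> R0" and "0 \<le> R0" "R0 \<le> R"
  shows "R\<^sup>2 * prob (space M - stay R n) + err R n \<le> R0\<^sup>2 + (\<Sum>k<n. (\<gamma> k)\<^sup>2)"
proof (induction n)
  case 0
  have "AE \<omega> in M. \<omega> \<in> stay R 0"
    using init by (rule AE_mp) (use \<open>R0 \<le> R\<close> in \<open>auto simp: stay_def iterate_def\<close>)
  then have "prob (space M - stay R 0) = 0"
    using prob_compl[OF sets_stay] prob_eq_1[OF sets_stay] by simp
  moreover have "err R 0 \<le> (\<integral>\<omega>. R0\<^sup>2 \<partial>M)"
    unfolding err_def
  proof (rule integral_mono_AE[OF integrable_err])
    show "AE \<omega> in M. indicator (stay R 0) \<omega> * (norm (iterate 0 \<omega> - m))\<^sup>2 \<le> R0\<^sup>2"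
      using init by eventually_elim (auto simp: indicator_def iterate_def intro!: power_mono)
  qed simp
  ultimately show ?case by (simp add: prob_space)
next
  case (Suc n)
  have sub: "stay R (Suc n) \<subseteq> stay R n" "stay R n \<subseteq> space M"
    by (auto simp: stay_def)
  have "prob (space M - stay R (Suc n)) = prob ((space M - stay R n) \<union> (stay R n - stay R (Suc n)))"
    using sub by (intro arg_cong[where f = prob]) auto
  also have "\<dots> = prob (space M - stay R n) + prob (stay R n - stay R (Suc n))"
    by (rule finite_measure_Union) auto
  finally have "prob (space M - stay R (Suc n)) =
      prob (space M - stay R n) + prob (stay R n - stay R (Suc n))" .
  \<comment> \<open>With \<open>c = 0\<close> only plain monotonicity is needed, and the exit
    probabilities telescope.\<close>
  moreover have "err R (Suc n) + R\<^sup>2 * prob (stay R n - stay R (Suc n)) \<le> err R n + (\<gamma> n)\<^sup>2"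
    using err_Suc_le[of R 0 n] monotone assms by simp
  ultimately show ?case
    using Suc by (simp add: algebra_simps)
qed

definition stay_forever :: "real \<Rightarrow> 'o set" where
  "stay_forever R = (\<Inter>n. stay R n)"

lemma sets_stay_forever [measurable]: "stay_forever R \<in> sets M"
  unfolding stay_forever_def by measurable

text \<open>The exit probability from the ball of radius \<open>R\<close>, once \<open>R\<close>
  exceeds the initial bound, is at most \<open>S / R\<^sup>2\<close> at every finite horizon, with
  \<open>S\<close> free of both horizon and radius. The horizon is sent to infinity first, then the
  radius.\<close>

lemma AE_stay_forever:
  assumes init: "AE \<omega> in M. norm (Y 0 \<omega> - m) \<le> R0"
    and sq: "summable (\<lambda>n. (\<gamma> n)\<^sup>2)"
  shows "AE \<omega> in M. \<exists>N::nat. \<omega> \<in> stay_forever (real N + 1)"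
proof -
  define R1 where "R1 = max R0 0"
  have init1: "AE \<omega> in M. norm (Y 0 \<omega> - m) \<le> R1"
    using init by eventually_elim (simp add: R1_def)
  define S where "S = R1\<^sup>2 + (\<Sum>k. (\<gamma> k)\<^sup>2)"
  define E where "E = space M - (\<Union>N::nat. stay_forever (real N + 1))"
  have [measurable]: "E \<in> sets M" unfolding E_def by measurable
  have le: "(real N + 1)\<^sup>2 * prob E \<le> S" if "real N \<ge> R1" for N
  proof -
    let ?R = "real N + 1"
    have bound: "?R\<^sup>2 * prob (space M - stay ?R n) \<le> S" for n
    proof -
      have "?R\<^sup>2 * prob (space M - stay ?R n) + err ?R n \<le> R1\<^sup>2 + (\<Sum>k<n. (\<gamma> k)\<^sup>2)"
        using that by (intro prob_exit_le init1) (auto simp: R1_def)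
      moreover have "0 \<le> err ?R n"
        unfolding err_def by simp
      moreover have "(\<Sum>k<n. (\<gamma> k)\<^sup>2) \<le> (\<Sum>k. (\<gamma> k)\<^sup>2)"
        using sq by (intro sum_le_suminf) auto
      ultimately show ?thesis by (simp add: S_def)
    qed
    \<comment> \<open>Continuity from below along the increasing exit events removes the
      horizon.\<close>
    have "(\<lambda>n. prob (space M - stay ?R n)) \<longlonglongrightarrow> prob (\<Union>n. space M - stay ?R n)"
      using decseqD[OF decseq_stay[of ?R]]
      by (intro finite_Lim_measure_incseq) (auto simp: incseq_def)
    then have lim: "(\<lambda>n. ?R\<^sup>2 * prob (space M - stay ?R n)) \<longlonglongrightarrow> ?R\<^sup>2 * prob (\<Union>n. space M - stay ?R n)"
      by (rule tendsto_mult_left)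
    have "?R\<^sup>2 * prob (\<Union>n. space M - stay ?R n) \<le> S"
      by (rule LIMSEQ_le_const2[OF lim]) (use bound in blast)
    moreover have "prob E \<le> prob (\<Union>n. space M - stay ?R n)"
      by (rule finite_measure_mono) (auto simp: E_def stay_forever_def)
    then have "?R\<^sup>2 * prob E \<le> ?R\<^sup>2 * prob (\<Union>n. space M - stay ?R n)"
      by (rule mult_left_mono) simp
    ultimately show ?thesis by linarith
  qed
  have "prob E = 0"
  proof (rule ccontr)
    assume "prob E \<noteq> 0"
    then have pos: "prob E > 0" by (simp add: zero_less_measure_iff)
    obtain N :: nat where N: "real N \<ge> max R1 (S / prob E)"
      using real_arch_simple by blast
    have "S \<le> real N * prob E"
      using N pos by (simp add: field_simps)
    also have "\<dots> < (real N + 1)\<^sup>2 * prob E"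
      using pos by (intro mult_strict_right_mono) (auto simp: power2_eq_square algebra_simps intro!: add_pos_nonneg)
    finally show False using le[of N] N by simp
  qed
  then have "E \<in> null_sets M"
    by (simp add: null_sets_def emeasure_eq_measure)
  from AE_not_in[OF this] show ?thesis
    by (rule AE_mp) (auto simp: E_def)
qed

lemma err_rate:
  fixes a c \<alpha> :: real
  assumes "0 \<le> R" "0 < c" "0 < a" "0 < \<alpha>" "\<alpha> < 1"
    and \<gamma>: "\<And>n. n \<ge> 1 \<Longrightarrow> \<gamma> n = a * real n powr -\<alpha>"
    and mono: "\<And>h. norm h \<le> R \<Longrightarrow> c * (norm h)\<^sup>2 \<le> (\<integral>x. inner h (sgn (m + h - x)) \<partial>\<mu>)"
  shows "\<exists>K\<ge>0. \<forall>\<^sub>F n in sequentially. err R n \<le> K * real n powr -\<alpha>"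
proof (rule powr_recursion_bound[where b = "2 * a * c" and q = "a\<^sup>2"])
  show "\<forall>\<^sub>F n in sequentially. err R (Suc n)
      \<le> (1 - 2 * a * c * real n powr -\<alpha>) * err R n + a\<^sup>2 * real n powr (- 2 * \<alpha>)"
    using eventually_ge_at_top[of 1]
  proof eventually_elim
    case (elim n)
    have sq: "(\<gamma> n)\<^sup>2 = a\<^sup>2 * real n powr (- 2 * \<alpha>)"
      by (simp add: \<gamma>[OF elim] power_mult_distrib power2_eq_square flip: powr_add)
    have "0 \<le> R\<^sup>2 * prob (stay R n - stay R (Suc n))" by simp
    with err_Suc_le[OF \<open>0 \<le> R\<close> less_imp_le[OF \<open>0 < c\<close>] mono, of n]
    have "err R (Suc n) \<le> (1 - 2 * \<gamma> n * c) * err R n + (\<gamma> n)\<^sup>2"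
      by linarith
    then show ?case
      unfolding sq by (simp add: \<gamma>[OF elim] mult_ac)
  qed
qed (use assms in auto)

text \<open>Inclusion is asked only almost everywhere, so \<open>\<Omega>\<close> may also contain a
  null set of escaping trajectories.\<close>

lemma expectation_stay_forever_le_err:
  assumes "\<Omega> \<in> sets M" and "AE \<omega> in M. \<omega> \<in> \<Omega> \<longrightarrow> \<omega> \<in> stay_forever R"
  shows "(\<integral>\<omega>. indicator \<Omega> \<omega> * (norm (iterate n \<omega> - m))\<^sup>2 \<partial>M) \<le> err R n"
  unfolding err_def
proof (rule integral_mono_AE'[OF integrable_err])
  show "AE \<omega> in M. indicator \<Omega> \<omega> * (norm (iterate n \<omega> - m))\<^sup>2
      \<le> indicator (stay R n) \<omega> * (norm (iterate n \<omega> - m))\<^sup>2"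
    using assms(2) by eventually_elim (auto simp: indicator_def stay_forever_def)
qed simp

end

section \<open>From the rate on each ball to the exhausting events\<close>

theorem proposition3p2:
  fixes P :: "'p measure" and X :: "'p \<Rightarrow> 'h::{real_inner, complete_space, second_countable_topology}"
    and m :: 'h
    and M :: "'o measure" and Xs :: "nat \<Rightarrow> 'o \<Rightarrow> 'h" and Z0 :: "'o \<Rightarrow> 'h" and Z :: "nat \<Rightarrow> 'o \<Rightarrow> 'h"
    and \<gamma> :: "nat \<Rightarrow> real" and c \<alpha> :: real
  assumes "prob_space P" and "X \<in> borel_measurable P"
    and "is_geometric_median P X m"
    and "not_on_line P X"
    and "mixture_condition P X m"
    and "inverse_square_condition P X m"
    and "prob_space M"
    and "prob_space.indep_vars M (\<lambda>_. borel) Xs {1..}"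
    and "\<And>n. n \<ge> 1 \<Longrightarrow> distr M borel (Xs n) = distr P borel X"
    and "Z0 \<in> borel_measurable M"
    and "prob_space.indep_set M
           (sets (vimage_algebra (space M) Z0 borel))
           (sets (vimage_algebra (space M) (\<lambda>\<omega>. \<lambda>n\<in>{1..}. Xs n \<omega>) (PiM {1..} (\<lambda>_. borel))))"
    and "\<exists>B. AE \<omega> in M. norm (Z0 \<omega>) \<le> B"
    and "c > 0" and "1/2 < \<alpha>" and "\<alpha> < 1"
    and "\<gamma> 0 > 0" and "\<And>n. n \<ge> 1 \<Longrightarrow> \<gamma> n = c * real n powr (-\<alpha>)"
    and "Z = median_sgd \<gamma> Z0 Xs"
  shows "\<exists>(\<Omega> :: nat \<Rightarrow> 'o set) (C :: nat \<Rightarrow> real).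
           (\<forall>N. \<Omega> N \<in> sets M) \<and> incseq \<Omega> \<and> (\<Union>N. \<Omega> N) = space M \<and>
           (\<forall>N. \<forall>\<^sub>F n in sequentially.
              (\<integral>\<omega>. indicator (\<Omega> N) \<omega> * (norm (Z n \<omega> - m))\<^sup>2 \<partial>M)
                \<le> C N * \<gamma> n * ln (\<Sum>k=1..n. \<gamma> k) \<and>
              (\<integral>\<omega>. indicator (\<Omega> N) \<omega> * (norm (Z n \<omega> - m))\<^sup>2 \<partial>M)
                \<le> C N * (ln (real n) / real n powr \<alpha>))"
proof -
  note P = assms(1,2) and \<gamma> = assms(17)
  have [measurable]: "X \<in> borel_measurable P" by fact
  interpret M: prob_space M by fact
  \<comment> \<open>The starting point takes index 0, so that start and samples form one independent
    family.\<close>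
  define Y where "Y = Xs(0 := Z0)"
  let ?\<mu> = "distr P borel X"
  have sgn_meas: "(\<lambda>x. inner h (sgn (m + h - x))) \<in> borel_measurable borel" for h :: 'h
    unfolding sgn_div_norm by measurable
  have drift: "(\<integral>x. inner h (sgn (m + h - x)) \<partial>?\<mu>) = (\<integral>\<omega>. inner h (sgn (m + h - X \<omega>)) \<partial>P)" for h
    by (rule integral_distr[OF P(2) sgn_meas])
  have strong: "\<exists>k>0. \<forall>h. norm h \<le> R \<longrightarrow>
      k * (norm h)\<^sup>2 \<le> (\<integral>x. inner h (sgn (m + h - x)) \<partial>?\<mu>)" if "R > 0" for R
    using geometric_median_strongly_monotone[OF P assms(3,4) that] unfolding drift by metis
  interpret localized_sgd M Y \<gamma> m ?\<mu>
  proof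
    have "insert 0 {1..} = (UNIV :: nat set)" by auto
    then show "M.indep_vars (\<lambda>_. borel) Y UNIV"
      using M.indep_vars_insert[of "\<lambda>_. borel" Xs "{1..}" 0 Z0] assms(8,10,11)
      by (simp add: Y_def)
    show "distr M borel (Y (Suc n)) = ?\<mu>" for n
      using assms(9)[of "Suc n"] by (simp add: Y_def)
    show "0 \<le> \<gamma> n" for n
      using \<gamma>[of n] assms(13,16) by (cases "n = 0") auto
    show "0 \<le> (\<integral>x. inner h (sgn (m + h - x)) \<partial>?\<mu>)" for h
    proof -
      \<comment> \<open>Strong monotonicity on a ball around each \<open>h\<close> implies plain
        monotonicity everywhere; adding 1 keeps the radius positive for
        \<open>h = 0\<close>.\<close>
      obtain k where "k > 0" "k * (norm h)\<^sup>2 \<le> (\<integral>x. inner h (sgn (m + h - x)) \<partial>?\<mu>)"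
        using strong[of "norm h + 1"] by (force simp: add_nonneg_pos)
      then show ?thesis
        by (meson less_imp_le mult_nonneg_nonneg order_trans zero_le_power2)
    qed
  qed
  have Z_eq: "Z n \<omega> = iterate n \<omega>" for n \<omega>
    unfolding assms(18) iterate_def unfolding Y_def by (rule median_sgd_eq_canonical)
  obtain B where B: "AE \<omega> in M. norm (Z0 \<omega>) \<le> B" using assms(12) by blast
  have "AE \<omega> in M. norm (Y 0 \<omega> - m) \<le> B + norm m"
    using B by eventually_elim (simp add: Y_def norm_triangle_le_diff)
  then have ae: "AE \<omega> in M. \<exists>N::nat. \<omega> \<in> stay_forever (real N + 1)"
    by (rule AE_stay_forever) (rule summable_power2_steps[OF assms(14) \<gamma>])
  \<comment> \<open>The trajectories that leave every ball. By \<open>ae\<close> they form a null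
    set, so adding \<open>E\<close> to every event makes the union all of the space without changing
    any expectation.\<close>
  define E where "E = space M - (\<Union>N::nat. stay_forever (real N + 1))"
  define \<Omega> where "\<Omega> = (\<lambda>N::nat. stay_forever (real N + 1) \<union> E)"
  have [measurable]: "E \<in> sets M" unfolding E_def by measurable
  have sub: "stay_forever R \<subseteq> space M" for R
    by (auto simp: stay_forever_def stay_def)
  have "\<exists>K\<ge>0. \<forall>\<^sub>F n in sequentially. err (real N + 1) n \<le> K * real n powr -\<alpha>" for N
  proof -
    obtain k where "k > 0" "\<And>h. norm h \<le> real N + 1 \<Longrightarrow>
        k * (norm h)\<^sup>2 \<le> (\<integral>x. inner h (sgn (m + h - x)) \<partial>?\<mu>)"
      using strong[of "real N + 1"] by auto
    then show ?thesis
      using assms(13-15) by (intro err_rate[where c = k and a = c] \<gamma>) auto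
  qed
  then obtain K where K: "\<And>N. K N \<ge> 0"
    "\<And>N. \<forall>\<^sub>F n in sequentially. err (real N + 1) n \<le> K N * real n powr -\<alpha>"
    by metis
  \<comment> \<open>The entry \<open>K N / c\<close> serves the bound in terms of
    \<open>\<gamma> n\<close>, which equals \<open>c * real n powr -\<alpha>\<close>; the entry
    \<open>K N\<close> serves the bound in powers of \<open>n\<close>.\<close>
  define C where "C = (\<lambda>N. max (K N) (K N / c))"
  show ?thesis
  proof (intro exI[of _ \<Omega>] exI[of _ C] conjI allI)
    show "\<Omega> N \<in> sets M" for N unfolding \<Omega>_def by measurable
    show "incseq \<Omega>"
    proof (rule incseq_SucI)
      fix N
      have "stay (real N + 1) n \<subseteq> stay (real (Suc N) + 1) n" for n
        by (rule stay_mono) simp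
      then show "\<Omega> N \<subseteq> \<Omega> (Suc N)"
        unfolding \<Omega>_def stay_forever_def by blast
    qed
    show "(\<Union>N. \<Omega> N) = space M"
      using sub by (auto simp: \<Omega>_def E_def)
    fix N
    have "\<forall>\<^sub>F n in sequentially. 1 \<le> ln (\<Sum>k = 1..n. c * real k powr -\<alpha>)"
      using assms(13-15) by (intro eventually_ln_sum_powr_ge_1) auto
    moreover have "\<forall>\<^sub>F n in sequentially. 1 \<le> ln (real n)"
      by real_asymp
    ultimately show "\<forall>\<^sub>F n in sequentially.
        (\<integral>\<omega>. indicator (\<Omega> N) \<omega> * (norm (Z n \<omega> - m))\<^sup>2 \<partial>M) \<le> C N * \<gamma> n * ln (\<Sum>k=1..n. \<gamma> k) \<and>
        (\<integral>\<omega>. indicator (\<Omega> N) \<omega> * (norm (Z n \<omega> - m))\<^sup>2 \<partial>M) \<le> C N * (ln (real n) / real n powr \<alpha>)"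
      using K(2)[of N] eventually_ge_at_top[of 1]
    proof eventually_elim
      case (elim n)
      have "(\<integral>\<omega>. indicator (\<Omega> N) \<omega> * (norm (Z n \<omega> - m))\<^sup>2 \<partial>M) \<le> err (real N + 1) n"
        unfolding Z_eq
      proof (rule expectation_stay_forever_le_err)
        show "AE \<omega> in M. \<omega> \<in> \<Omega> N \<longrightarrow> \<omega> \<in> stay_forever (real N + 1)"
          using ae by eventually_elim (auto simp: \<Omega>_def E_def)
      qed (simp add: \<Omega>_def)
      also have "\<dots> \<le> K N * real n powr -\<alpha>" by (rule elim)
      finally have le: "(\<integral>\<omega>. indicator (\<Omega> N) \<omega> * (norm (Z n \<omega> - m))\<^sup>2 \<partial>M) \<le> K N * real n powr -\<alpha>" .
      have sum_eq: "(\<Sum>k=1..n. \<gamma> k) = (\<Sum>k=1..n. c * real k powr -\<alpha>)"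
        by (rule sum.cong) (auto simp: \<gamma>)
      have C: "K N \<le> C N" "K N / c \<le> C N" "0 \<le> C N"
        using K(1)[of N] by (auto simp: C_def)
      have "K N * real n powr -\<alpha> = K N / c * \<gamma> n"
        using \<gamma>[OF elim(4)] assms(13) by simp
      also have "\<dots> \<le> C N * \<gamma> n"
        by (intro mult_right_mono C \<gamma>_nonneg)
      also have "\<dots> \<le> C N * \<gamma> n * ln (\<Sum>k=1..n. \<gamma> k)"
        unfolding sum_eq using elim(1) mult_nonneg_nonneg[OF C(3) \<gamma>_nonneg]
        by (metis mult.right_neutral mult_left_mono)
      finally have 1: "K N * real n powr -\<alpha> \<le> C N * \<gamma> n * ln (\<Sum>k=1..n. \<gamma> k)" .
      have "K N * real n powr -\<alpha> \<le> C N * real n powr -\<alpha> * 1"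
        using C by (simp add: mult_right_mono)
      also have "\<dots> \<le> C N * real n powr -\<alpha> * ln (real n)"
        by (intro mult_left_mono elim) (use C in simp)
      also have "\<dots> = C N * (ln (real n) / real n powr \<alpha>)"
        by (simp add: powr_minus divide_inverse)
      finally have 2: "K N * real n powr -\<alpha> \<le> C N * (ln (real n) / real n powr \<alpha>)" .
      from le 1 2 show ?case by linarith
    qed
  qed
qed

end
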